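(* Let $F$ be a field, let $n$ be a positive integer, and let $\mathcal{L} = \{(i_1, j_1)\}$ be a $1$-step ladder on $n$, i.e. $i_1, j_1$ are integers with $1 \leq i_1 \leq n$ and $1 \leq j_1 \leq n$. Then the ladder matrix Lie algebra $M_{\mathcal{L}} = \operatorname{Span}\{ e_{i,j} \mid 1 \leq i \leq i_1 \text{ and } j_1 \leq j \leq n \}$, considered as an algebra over $F$ under the Lie bracket $[x,y] = xy - yx$, is zero product determined.
   Context: $M^{n\times n}_F$ denotes the space of $n$-by-$n$ matrices with entries in the field $F$, and $e_{i,j} \in M^{n \times n}_F$ is the matrix whose $(i,j)$ entry is $1$ and whose other entries are $0$. Span is taken over $F$. A $k$-step ladder on $n$ is a set of pairs of positive integers $\mathcal{L} = \{(i_1,j_1),\dots,(i_k,j_k)\}$ with $1 \leq i_1 < i_2 < \dots < i_k \leq n$ and $1 \leq j_1 < j_2 < \dots < j_k \leq n$. The ladder matrices on $\mathcal{L}$ is the subspace $M_{\mathcal{L}} = \operatorname{Span} \bigcup_{t=1}^k \{ e_{i,j} \mid 1 \leq i \leq i_t \text{ and } j_t \leq j \leq n \}$ of $M^{n\times n}_F$. A ladder is upper triangular if $i_t < j_{t+1}$ for $t = 1, \dots, k-1$ (vacuous when $k=1$); it is known that $M_{\mathcal{L}}$ is closed under matrix multiplication, hence under the Lie bracket, when $\mathcal{L}$ is upper triangular. An algebra over $F$ is a pair $(A,\mu)$ where $A$ is a vector space over $F$ and $\mu : A \otimes A \to A$ is an $F$-linear map (not assumed associative); $A^2$ denotes the image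 of $\mu$. Here $A = M_{\mathcal{L}}$ and $\mu(x \otimes y) = [x,y] = xy - yx$. An algebra $(A,\mu)$ is zero product determined if for every vector space $X$ over $F$ and every $F$-linear map $\varphi : A \otimes A \to X$ satisfying, for all $x,y \in A$, $\varphi(x \otimes y) = 0$ whenever $\mu(x \otimes y) = 0$, there is a linear map $f : A^2 \to X$ such that $\varphi = f \circ \mu$. *)

theory Defs
  imports "Jordan_Normal_Form.VS_Connect" "HOL-Algebra.AbelCoset"
begin

section \<open>Tensor products of vector spaces\<close>

text \<open>The free vector space on a set \<open>S\<close>: finitely supported functions from \<open>S\<close> to \<open>K\<close>.\<close>

definition free_vs :: "('k, 'r) ring_scheme \<Rightarrow> 's set \<Rightarrow> ('k, 's \<Rightarrow> 'k) module" where
  "free_vs K S = (ring.func_space K S)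
     \<lparr>carrier := {u \<in> S \<rightarrow>\<^sub>E carrier K. finite {s \<in> S. u s \<noteq> \<zero>\<^bsub>K\<^esub>}}\<rparr>"

definition free_gen :: "('k, 'r) ring_scheme \<Rightarrow> 's set \<Rightarrow> 's \<Rightarrow> 's \<Rightarrow> 'k" where
  "free_gen K S s = (\<lambda>t\<in>S. if t = s then \<one>\<^bsub>K\<^esub> else \<zero>\<^bsub>K\<^esub>)"

text \<open>The scalar action on cosets adds \<open>N\<close> back in, since \<open>c = \<zero>\<close> would otherwise
  collapse a coset to \<open>{\<zero>}\<close>. The ring fields \<open>mult\<close> and \<open>one\<close> of the record play no role.\<close>

definition quotient_module :: "('k, 'v, 'm) module_scheme \<Rightarrow> 'v set \<Rightarrow> ('k, 'v set) module" where
  "quotient_module M N =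
     \<lparr>carrier = a_rcosets\<^bsub>M\<^esub> N, mult = (\<lambda>_ _. N), one = N, zero = N,
      add = (\<lambda>C D. C <+>\<^bsub>M\<^esub> D),
      smult = (\<lambda>c C. N <+>\<^bsub>M\<^esub> ((\<lambda>x. c \<odot>\<^bsub>M\<^esub> x) ` C))\<rparr>"

definition tensor_relations ::
  "('k, 'r) ring_scheme \<Rightarrow> ('k, 'v, 'm) module_scheme \<Rightarrow> ('k, 'w, 'n) module_scheme
    \<Rightarrow> ('v \<times> 'w \<Rightarrow> 'k) set" where
  "tensor_relations K V W =
    (let S = carrier V \<times> carrier W; E = free_vs K S; g = (\<lambda>v w. free_gen K S (v, w)) in
      {g (v \<oplus>\<^bsub>V\<^esub> v') w \<ominus>\<^bsub>E\<^esub> (g v w \<oplus>\<^bsub>E\<^esub> g v' w) |v v' w.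
         v \<in> carrier V \<and> v' \<in> carrier V \<and> w \<in> carrier W} \<union>
      {g v (w \<oplus>\<^bsub>W\<^esub> w') \<ominus>\<^bsub>E\<^esub> (g v w \<oplus>\<^bsub>E\<^esub> g v w') |v w w'.
         v \<in> carrier V \<and> w \<in> carrier W \<and> w' \<in> carrier W} \<union>
      {g (c \<odot>\<^bsub>V\<^esub> v) w \<ominus>\<^bsub>E\<^esub> c \<odot>\<^bsub>E\<^esub> g v w |c v w.
         c \<in> carrier K \<and> v \<in> carrier V \<and> w \<in> carrier W} \<union>
      {g v (c \<odot>\<^bsub>W\<^esub> w) \<ominus>\<^bsub>E\<^esub> c \<odot>\<^bsub>E\<^esub> g v w |c v w.
         c \<in> carrier K \<and> v \<in> carrier V \<and> w \<in> carrier W})"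

definition tensor_null ::
  "('k, 'r) ring_scheme \<Rightarrow> ('k, 'v, 'm) module_scheme \<Rightarrow> ('k, 'w, 'n) module_scheme
    \<Rightarrow> ('v \<times> 'w \<Rightarrow> 'k) set" where
  "tensor_null K V W = LinearCombinations.module.span K (free_vs K (carrier V \<times> carrier W))
     (tensor_relations K V W)"

definition tensor ::
  "('k, 'r) ring_scheme \<Rightarrow> ('k, 'v, 'm) module_scheme \<Rightarrow> ('k, 'w, 'n) module_scheme
    \<Rightarrow> ('k, ('v \<times> 'w \<Rightarrow> 'k) set) module" where
  "tensor K V W = quotient_module (free_vs K (carrier V \<times> carrier W)) (tensor_null K V W)"

text \<open>The elementary tensor \<open>v \<otimes> w\<close>, as a coset.\<close>

definition pure_tensor ::
  "('k, 'r) ring_scheme \<Rightarrow> ('k, 'v, 'm) module_scheme \<Rightarrow> ('k, 'w, 'n) module_scheme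
    \<Rightarrow> 'v \<Rightarrow> 'w \<Rightarrow> ('v \<times> 'w \<Rightarrow> 'k) set" where
  "pure_tensor K V W v w = tensor_null K V W +>\<^bsub>free_vs K (carrier V \<times> carrier W)\<^esub>
     free_gen K (carrier V \<times> carrier W) (v, w)"

text \<open>The linear map on \<open>V \<otimes> W\<close> induced by a bilinear map \<open>b\<close> with values in \<open>U\<close>, computed on
  an arbitrary representative; see \<open>tensor_lift_linear\<close> and \<open>tensor_lift_pure\<close> below.\<close>

definition free_eval ::
  "('k, 'r) ring_scheme \<Rightarrow> 's set \<Rightarrow> ('k, 'u, 'm) module_scheme \<Rightarrow> ('s \<Rightarrow> 'u)
    \<Rightarrow> ('s \<Rightarrow> 'k) \<Rightarrow> 'u" where
  "free_eval K S U h u = (\<Oplus>\<^bsub>U\<^esub>s\<in>{s \<in> S. u s \<noteq> \<zero>\<^bsub>K\<^esub>}. u s \<odot>\<^bsub>U\<^esub> h s)"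

definition tensor_lift ::
  "('k, 'r) ring_scheme \<Rightarrow> ('k, 'v, 'm) module_scheme \<Rightarrow> ('k, 'w, 'n) module_scheme
    \<Rightarrow> ('k, 'u, 'p) module_scheme \<Rightarrow> ('v \<Rightarrow> 'w \<Rightarrow> 'u) \<Rightarrow> ('v \<times> 'w \<Rightarrow> 'k) set \<Rightarrow> 'u" where
  "tensor_lift K V W U b T =
     free_eval K (carrier V \<times> carrier W) U (\<lambda>(v, w). b v w) (SOME u. u \<in> T)"

definition bilinear_map ::
  "('k, 'r) ring_scheme \<Rightarrow> ('k, 'v, 'm) module_scheme \<Rightarrow> ('k, 'w, 'n) module_scheme
    \<Rightarrow> ('k, 'u, 'p) module_scheme \<Rightarrow> ('v \<Rightarrow> 'w \<Rightarrow> 'u) \<Rightarrow> bool" where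
  "bilinear_map K V W U b \<longleftrightarrow>
     (\<forall>v\<in>carrier V. b v \<in> LinearCombinations.module_hom K W U) \<and>
     (\<forall>w\<in>carrier W. (\<lambda>v. b v w) \<in> LinearCombinations.module_hom K V U)"

lemma free_vs_simps:
  assumes "ring K"
  shows "carrier (free_vs K S) = {u \<in> S \<rightarrow>\<^sub>E carrier K. finite {s \<in> S. u s \<noteq> \<zero>\<^bsub>K\<^esub>}}"
    "\<zero>\<^bsub>free_vs K S\<^esub> = (\<lambda>s\<in>S. \<zero>\<^bsub>K\<^esub>)"
    "u \<oplus>\<^bsub>free_vs K S\<^esub> v = (\<lambda>s\<in>S. u s \<oplus>\<^bsub>K\<^esub> v s)"
    "c \<odot>\<^bsub>free_vs K S\<^esub> u = (\<lambda>s\<in>S. c \<otimes>\<^bsub>K\<^esub> u s)"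
  by (simp_all add: free_vs_def ring.func_space_def[OF assms])

lemma free_vs_module:
  assumes "field K" shows "module K (free_vs K S)"
proof -
  interpret K: field K by fact
  have m: "module K (K.func_space S)" by (rule K.func_space_is_module)
  interpret F: Module.module K "K.func_space S" by fact
  have "submodule K {u \<in> S \<rightarrow>\<^sub>E carrier K. finite {s \<in> S. u s \<noteq> \<zero>\<^bsub>K\<^esub>}} (K.func_space S)"
  proof (unfold_locales, goal_cases)
    case 1 then show ?case by (auto simp: K.func_space_def)
  next
    case (2 v w)
    then have "finite ({s \<in> S. v s \<noteq> \<zero>\<^bsub>K\<^esub>} \<union> {s \<in> S. w s \<noteq> \<zero>\<^bsub>K\<^esub>})" by auto
    moreover have "{s \<in> S. v s \<oplus>\<^bsub>K\<^esub> w s \<noteq> \<zero>\<^bsub>K\<^esub>} \<subseteq> {s \<in> S. v s \<noteq> \<zero>\<^bsub>K\<^esub>} \<union> {s \<in> S. w s \<noteq> \<zero>\<^bsub>K\<^esub>}" by auto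
    ultimately have "finite {s \<in> S. v s \<oplus>\<^bsub>K\<^esub> w s \<noteq> \<zero>\<^bsub>K\<^esub>}" by (rule rev_finite_subset)
    with 2 show ?case by (auto simp: K.func_space_def PiE_iff cong: conj_cong)
  next
    case 3 show ?case by (auto simp: K.func_space_def cong: conj_cong)
  next
    case (4 c v)
    then have "finite {s \<in> S. v s \<noteq> \<zero>\<^bsub>K\<^esub>}" by auto
    moreover have "{s \<in> S. c \<otimes>\<^bsub>K\<^esub> v s \<noteq> \<zero>\<^bsub>K\<^esub>} \<subseteq> {s \<in> S. v s \<noteq> \<zero>\<^bsub>K\<^esub>}" using 4 by auto
    ultimately have "finite {s \<in> S. c \<otimes>\<^bsub>K\<^esub> v s \<noteq> \<zero>\<^bsub>K\<^esub>}" by (rule rev_finite_subset)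
    with 4 show ?case by (auto simp: K.func_space_def PiE_iff cong: conj_cong)
  qed
  then show ?thesis
    unfolding free_vs_def by (rule F.submodule_is_module)
qed

lemma free_gen_closed:
  assumes "field K" "s \<in> S" shows "free_gen K S s \<in> carrier (free_vs K S)"
proof -
  interpret K: field K by fact
  have "{t \<in> S. free_gen K S s t \<noteq> \<zero>\<^bsub>K\<^esub>} \<subseteq> {s}" by (auto simp: free_gen_def)
  then have "finite {t \<in> S. free_gen K S s t \<noteq> \<zero>\<^bsub>K\<^esub>}" by (rule finite_subset) simp
  then show ?thesis by (auto simp: free_vs_simps[OF K.ring_axioms] free_gen_def)
qed

context
  fixes K (structure) and M :: "('k, 'v, 'm) module_scheme" and N
  assumes mod: "module K M" and sub: "submodule K N M"
begin

interpretation M: Module.module K M by (rule mod)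
interpretation N: submodule K N M by (rule sub)

lemma coset_subgroup: "abelian_subgroup N M"
proof (rule abelian_subgroupI3)
  show "additive_subgroup N M"
  proof (intro additive_subgroup.intro)
    show "subgroup N (add_monoid M)"
    proof (rule M.add.subgroupI)
      show "N \<subseteq> carrier M" by (rule N.subset)
      show "N \<noteq> {}" using N.zero_closed by blast
      fix a assume a: "a \<in> N"
      then have "a \<in> carrier M" using N.subset by auto
      then have "\<ominus>\<^bsub>M\<^esub> a = (\<ominus> \<one>) \<odot>\<^bsub>M\<^esub> a" by (simp add: M.smult_l_minus)
      then show "\<ominus>\<^bsub>M\<^esub> a \<in> N" using a by auto
    qed auto
  qed
qed (rule M.abelian_group_axioms)

interpretation C: abelian_subgroup N M by (rule coset_subgroup)

lemma coset_add:
  "x \<in> carrier M \<Longrightarrow> y \<in> carrier M \<Longrightarrow> (N +>\<^bsub>M\<^esub> x) <+>\<^bsub>M\<^esub> (N +>\<^bsub>M\<^esub> y) = N +>\<^bsub>M\<^esub> (x \<oplus>\<^bsub>M\<^esub> y)"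
  by (rule C.a_rcos_sum)

lemma coset_smult:
  assumes c: "c \<in> carrier K" and x: "x \<in> carrier M"
  shows "N <+>\<^bsub>M\<^esub> ((\<lambda>x. c \<odot>\<^bsub>M\<^esub> x) ` (N +>\<^bsub>M\<^esub> x)) = N +>\<^bsub>M\<^esub> (c \<odot>\<^bsub>M\<^esub> x)"
proof -
  have NC: "h \<in> N \<Longrightarrow> h \<in> carrier M" for h using N.subset by auto
  show ?thesis
  proof
    show "N <+>\<^bsub>M\<^esub> ((\<lambda>x. c \<odot>\<^bsub>M\<^esub> x) ` (N +>\<^bsub>M\<^esub> x)) \<subseteq> N +>\<^bsub>M\<^esub> (c \<odot>\<^bsub>M\<^esub> x)"
    proof
      fix z assume "z \<in> N <+>\<^bsub>M\<^esub> ((\<lambda>x. c \<odot>\<^bsub>M\<^esub> x) ` (N +>\<^bsub>M\<^esub> x))"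
      then obtain h h' where h: "h \<in> N" "h' \<in> N" "z = h \<oplus>\<^bsub>M\<^esub> c \<odot>\<^bsub>M\<^esub> (h' \<oplus>\<^bsub>M\<^esub> x)"
        unfolding set_add_def' a_r_coset_def' by blast
      then have "z = (h \<oplus>\<^bsub>M\<^esub> c \<odot>\<^bsub>M\<^esub> h') \<oplus>\<^bsub>M\<^esub> c \<odot>\<^bsub>M\<^esub> x"
        using c x NC by (simp add: M.smult_r_distr M.a_assoc)
      moreover have "h \<oplus>\<^bsub>M\<^esub> c \<odot>\<^bsub>M\<^esub> h' \<in> N"
        using h(1,2) c by simp
      ultimately have "\<exists>k\<in>N. z = k \<oplus>\<^bsub>M\<^esub> c \<odot>\<^bsub>M\<^esub> x" by (rule bexI)
      then show "z \<in> N +>\<^bsub>M\<^esub> (c \<odot>\<^bsub>M\<^esub> x)"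
        unfolding a_r_coset_def' by blast
    qed
    show "N +>\<^bsub>M\<^esub> (c \<odot>\<^bsub>M\<^esub> x) \<subseteq> N <+>\<^bsub>M\<^esub> ((\<lambda>x. c \<odot>\<^bsub>M\<^esub> x) ` (N +>\<^bsub>M\<^esub> x))"
    proof
      fix z assume "z \<in> N +>\<^bsub>M\<^esub> (c \<odot>\<^bsub>M\<^esub> x)"
      then obtain h where h: "h \<in> N" "z = h \<oplus>\<^bsub>M\<^esub> c \<odot>\<^bsub>M\<^esub> x"
        unfolding a_r_coset_def' by blast
      then have "z = h \<oplus>\<^bsub>M\<^esub> c \<odot>\<^bsub>M\<^esub> (\<zero>\<^bsub>M\<^esub> \<oplus>\<^bsub>M\<^esub> x)" using x by simp
      then have "\<exists>h\<in>N. \<exists>h'\<in>N. z = h \<oplus>\<^bsub>M\<^esub> c \<odot>\<^bsub>M\<^esub> (h' \<oplus>\<^bsub>M\<^esub> x)"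
        by (intro bexI[OF _ h(1)] bexI[OF _ N.zero_closed])
      then show "z \<in> N <+>\<^bsub>M\<^esub> ((\<lambda>x. c \<odot>\<^bsub>M\<^esub> x) ` (N +>\<^bsub>M\<^esub> x))"
        unfolding set_add_def' a_r_coset_def' by blast
    qed
  qed
qed

lemma coset_cases:
  assumes "D \<in> carrier (quotient_module M N)"
  obtains x where "x \<in> carrier M" "D = N +>\<^bsub>M\<^esub> x"
  using assms by (auto simp: quotient_module_def A_RCOSETS_def')

lemma quotient_module_simps:
  "x \<in> carrier M \<Longrightarrow> N +>\<^bsub>M\<^esub> x \<in> carrier (quotient_module M N)"
  "\<zero>\<^bsub>quotient_module M N\<^esub> = N"
  "x \<in> carrier M \<Longrightarrow> y \<in> carrier M \<Longrightarrow>
     (N +>\<^bsub>M\<^esub> x) \<oplus>\<^bsub>quotient_module M N\<^esub> (N +>\<^bsub>M\<^esub> y) = N +>\<^bsub>M\<^esub> (x \<oplus>\<^bsub>M\<^esub> y)"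
  "c \<in> carrier K \<Longrightarrow> x \<in> carrier M \<Longrightarrow>
     c \<odot>\<^bsub>quotient_module M N\<^esub> (N +>\<^bsub>M\<^esub> x) = N +>\<^bsub>M\<^esub> (c \<odot>\<^bsub>M\<^esub> x)"
  by (auto simp: quotient_module_def A_RCOSETS_def' coset_add coset_smult)

lemma quotient_module_is_module: "module K (quotient_module M N)"
proof (rule moduleI)
  show "cring K" using mod by (rule Module.module.axioms)
  have N0: "N = N +>\<^bsub>M\<^esub> \<zero>\<^bsub>M\<^esub>" by (simp add: N.subset)
  show "abelian_group (quotient_module M N)"
  proof (rule abelian_groupI)
    show "\<zero>\<^bsub>quotient_module M N\<^esub> \<in> carrier (quotient_module M N)"
      by (subst quotient_module_simps(2), subst N0) (simp add: quotient_module_simps)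
  next
    fix D assume "D \<in> carrier (quotient_module M N)"
    then obtain x where x: "x \<in> carrier M" "D = N +>\<^bsub>M\<^esub> x" by (rule coset_cases)
    then show "\<zero>\<^bsub>quotient_module M N\<^esub> \<oplus>\<^bsub>quotient_module M N\<^esub> D = D"
      by (subst quotient_module_simps(2), subst N0) (simp add: quotient_module_simps)
    show "\<exists>C\<in>carrier (quotient_module M N). C \<oplus>\<^bsub>quotient_module M N\<^esub> D = \<zero>\<^bsub>quotient_module M N\<^esub>"
      using x by (intro bexI[of _ "N +>\<^bsub>M\<^esub> (\<ominus>\<^bsub>M\<^esub> x)"])
        (simp_all add: quotient_module_simps M.l_neg N0[symmetric])
  qed (elim coset_cases, simp add: quotient_module_simps M.a_ac)+
qed (elim coset_cases, simp add: quotient_module_simps M.smult_l_distr M.smult_r_distr M.smult_assoc1)+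

end

lemma coset_eqI:
  assumes mod: "module K M" and sub: "submodule K N M"
    and "x \<in> carrier M" "y \<in> carrier M" "x \<ominus>\<^bsub>M\<^esub> y \<in> N"
  shows "N +>\<^bsub>M\<^esub> x = N +>\<^bsub>M\<^esub> y"
proof -
  interpret M: Module.module K M by (rule mod)
  interpret C: abelian_subgroup N M by (rule coset_subgroup[OF mod sub])
  have "x = (x \<ominus>\<^bsub>M\<^esub> y) \<oplus>\<^bsub>M\<^esub> y"
    using assms by (simp add: a_minus_def M.a_assoc M.l_neg)
  then have "x \<in> N +>\<^bsub>M\<^esub> y"
    using assms(5) unfolding a_r_coset_def' by auto
  then show ?thesis
    using C.a_repr_independence' assms(4) by metis
qed

lemma tensor_relations_closed:
  assumes K: "field K" and V: "module K V" and W: "module K W"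
  shows "tensor_relations K V W \<subseteq> carrier (free_vs K (carrier V \<times> carrier W))"
proof -
  interpret E: Module.module K "free_vs K (carrier V \<times> carrier W)" by (rule free_vs_module[OF K])
  interpret V: Module.module K V by (rule V)
  interpret W: Module.module K W by (rule W)
  show ?thesis
    unfolding tensor_relations_def Let_def
    by (auto intro!: E.minus_closed E.add.m_closed E.smult_closed free_gen_closed[OF K])
qed

lemma tensor_null_submodule:
  assumes K: "field K" and V: "module K V" and W: "module K W"
  shows "submodule K (tensor_null K V W) (free_vs K (carrier V \<times> carrier W))"
proof -
  interpret E: Module.module K "free_vs K (carrier V \<times> carrier W)" by (rule free_vs_module[OF K])
  show ?thesis
    unfolding tensor_null_def
    by (rule E.span_is_submodule) (rule tensor_relations_closed[OF assms])
qed

lemma tensor_vectorspace: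
  assumes "field K" "module K V" "module K W"
  shows "vectorspace K (tensor K V W)"
  unfolding tensor_def
  by (intro vectorspace.intro quotient_module_is_module free_vs_module tensor_null_submodule assms)

lemma pure_tensor_closed:
  assumes "field K" "module K V" "module K W" "v \<in> carrier V" "w \<in> carrier W"
  shows "pure_tensor K V W v w \<in> carrier (tensor K V W)"
  unfolding tensor_def pure_tensor_def using assms
  by (intro quotient_module_simps(1)[of K] free_vs_module tensor_null_submodule free_gen_closed) auto

lemma pure_tensor_bilinear:
  assumes K: "field K" and V: "module K V" and W: "module K W"
  shows "bilinear_map K V W (tensor K V W) (pure_tensor K V W)"
proof -
  let ?S = "carrier V \<times> carrier W"
  let ?E = "free_vs K ?S"
  let ?N = "tensor_null K V W"
  note E = free_vs_module[OF K, of ?S]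
  note N = tensor_null_submodule[OF assms]
  interpret E: Module.module K ?E by (rule E)
  interpret V: Module.module K V by (rule V)
  interpret W: Module.module K W by (rule W)
  have rel: "r \<in> ?N" if "r \<in> tensor_relations K V W" for r
    unfolding tensor_null_def
    using E.in_own_span[OF tensor_relations_closed[OF assms]] that by auto
  note g = free_gen_closed[OF K, where S = ?S]
  note s = quotient_module_simps(3,4)[OF E N, folded tensor_def]
  have t1: "pure_tensor K V W (v \<oplus>\<^bsub>V\<^esub> v') w =
      pure_tensor K V W v w \<oplus>\<^bsub>tensor K V W\<^esub> pure_tensor K V W v' w"
    if "v \<in> carrier V" "v' \<in> carrier V" "w \<in> carrier W" for v v' w
    unfolding pure_tensor_def using that
    by (subst s, (auto intro!: g)[2], intro coset_eqI[OF E N] rel)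
      (simp_all add: g, unfold tensor_relations_def Let_def, blast)
  have t2: "pure_tensor K V W v (w \<oplus>\<^bsub>W\<^esub> w') =
      pure_tensor K V W v w \<oplus>\<^bsub>tensor K V W\<^esub> pure_tensor K V W v w'"
    if "v \<in> carrier V" "w' \<in> carrier W" "w \<in> carrier W" for v w' w
    unfolding pure_tensor_def using that
    by (subst s, (auto intro!: g)[2], intro coset_eqI[OF E N] rel)
      (simp_all add: g, unfold tensor_relations_def Let_def, blast)
  have t3: "pure_tensor K V W (c \<odot>\<^bsub>V\<^esub> v) w = c \<odot>\<^bsub>tensor K V W\<^esub> pure_tensor K V W v w"
    if "v \<in> carrier V" "c \<in> carrier K" "w \<in> carrier W" for v c w
    unfolding pure_tensor_def using that
    by (subst s, simp, (auto intro!: g)[1], intro coset_eqI[OF E N] rel)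
      (simp_all add: g, unfold tensor_relations_def Let_def, blast)
  have t4: "pure_tensor K V W v (c \<odot>\<^bsub>W\<^esub> w) = c \<odot>\<^bsub>tensor K V W\<^esub> pure_tensor K V W v w"
    if "v \<in> carrier V" "c \<in> carrier K" "w \<in> carrier W" for v c w
    unfolding pure_tensor_def using that
    by (subst s, simp, (auto intro!: g)[1], intro coset_eqI[OF E N] rel)
      (simp_all add: g, unfold tensor_relations_def Let_def, blast)
  show ?thesis
    unfolding bilinear_map_def LinearCombinations.module_hom_def
    using t1 t2 t3 t4 pure_tensor_closed[OF assms] by auto
qed

context
  fixes K :: "('k, 'r) ring_scheme" and U :: "('k, 'u, 'm) module_scheme"
    and S :: "'s set" and h :: "'s \<Rightarrow> 'u"
  assumes K: "field K" and U: "module K U" and h: "h \<in> S \<rightarrow> carrier U"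
begin

interpretation K: field K by (rule K)
interpretation U: Module.module K U by (rule U)
interpretation E: Module.module K "free_vs K S" by (rule free_vs_module[OF K])

lemma free_eval_superset:
  assumes "u \<in> carrier (free_vs K S)" "finite T" "T \<subseteq> S" "{s \<in> S. u s \<noteq> \<zero>\<^bsub>K\<^esub>} \<subseteq> T"
  shows "free_eval K S U h u = (\<Oplus>\<^bsub>U\<^esub>s\<in>T. u s \<odot>\<^bsub>U\<^esub> h s)"
proof -
  have u: "u s \<in> carrier K" if "s \<in> S" for s
    using assms(1) that by (auto simp: free_vs_simps[OF K.ring_axioms])
  have hs: "h s \<in> carrier U" if "s \<in> S" for s using h that by auto
  show ?thesis
    unfolding free_eval_def
  proof (rule U.add.finprod_mono_neutral_cong_left)
    show "\<And>s. s \<in> T - {s \<in> S. u s \<noteq> \<zero>\<^bsub>K\<^esub>} \<Longrightarrow> u s \<odot>\<^bsub>U\<^esub> h s = \<zero>\<^bsub>U\<^esub>"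
      using assms(3) hs by auto
    show "(\<lambda>s. u s \<odot>\<^bsub>U\<^esub> h s) \<in> T \<rightarrow> carrier U" using assms(3) u hs by auto
  qed (use assms in auto)
qed

lemma free_eval_hom: "free_eval K S U h \<in> LinearCombinations.module_hom K (free_vs K S) U"
proof -
  note f = free_vs_simps[OF K.ring_axioms]
  let ?T = "\<lambda>u. {s \<in> S. u s \<noteq> \<zero>\<^bsub>K\<^esub>}"
  have u: "u s \<in> carrier K" if "u \<in> carrier (free_vs K S)" "s \<in> S" for s u
    using that by (auto simp: f)
  have fin: "finite (?T u)" if "u \<in> carrier (free_vs K S)" for u
    using that by (auto simp: f)
  have hs: "h s \<in> carrier U" if "s \<in> S" for s using h that by auto
  have cl: "free_eval K S U h u \<in> carrier U" if "u \<in> carrier (free_vs K S)" for u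
    unfolding free_eval_def using u[OF that] hs by (intro U.finsum_closed) auto
  have add: "free_eval K S U h (u \<oplus>\<^bsub>free_vs K S\<^esub> v) = free_eval K S U h u \<oplus>\<^bsub>U\<^esub> free_eval K S U h v"
    if uv: "u \<in> carrier (free_vs K S)" "v \<in> carrier (free_vs K S)" for u v
  proof -
    let ?R = "?T u \<union> ?T v"
    have R: "finite ?R" "?R \<subseteq> S" using fin uv by auto
    have R': "s \<in> ?R \<Longrightarrow> s \<in> S" for s by auto
    have sub: "?T (u \<oplus>\<^bsub>free_vs K S\<^esub> v) \<subseteq> ?R"
      by (auto simp: f(3))
    have "free_eval K S U h (u \<oplus>\<^bsub>free_vs K S\<^esub> v) =
        (\<Oplus>\<^bsub>U\<^esub>s\<in>?R. (u \<oplus>\<^bsub>free_vs K S\<^esub> v) s \<odot>\<^bsub>U\<^esub> h s)"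
      using uv R sub by (intro free_eval_superset) auto
    also have "\<dots> = (\<Oplus>\<^bsub>U\<^esub>s\<in>?R. u s \<odot>\<^bsub>U\<^esub> h s \<oplus>\<^bsub>U\<^esub> v s \<odot>\<^bsub>U\<^esub> h s)"
      using u[OF uv(1)] u[OF uv(2)] hs
      by (intro U.finsum_cong') (auto simp: f(3) U.smult_l_distr)
    also have "\<dots> = (\<Oplus>\<^bsub>U\<^esub>s\<in>?R. u s \<odot>\<^bsub>U\<^esub> h s) \<oplus>\<^bsub>U\<^esub> (\<Oplus>\<^bsub>U\<^esub>s\<in>?R. v s \<odot>\<^bsub>U\<^esub> h s)"
      using u[OF uv(1)] u[OF uv(2)] hs by (intro U.finsum_addf) auto
    also have "(\<Oplus>\<^bsub>U\<^esub>s\<in>?R. u s \<odot>\<^bsub>U\<^esub> h s) = free_eval K S U h u"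
      using uv R by (intro free_eval_superset[symmetric]) auto
    also have "(\<Oplus>\<^bsub>U\<^esub>s\<in>?R. v s \<odot>\<^bsub>U\<^esub> h s) = free_eval K S U h v"
      using uv R by (intro free_eval_superset[symmetric]) auto
    finally show ?thesis .
  qed
  have smult: "free_eval K S U h (c \<odot>\<^bsub>free_vs K S\<^esub> v) = c \<odot>\<^bsub>U\<^esub> free_eval K S U h v"
    if c: "c \<in> carrier K" and v: "v \<in> carrier (free_vs K S)" for c v
  proof -
    have sub: "?T (c \<odot>\<^bsub>free_vs K S\<^esub> v) \<subseteq> ?T v"
      using c by (auto simp: f(4))
    have "free_eval K S U h (c \<odot>\<^bsub>free_vs K S\<^esub> v) =
        (\<Oplus>\<^bsub>U\<^esub>s\<in>?T v. (c \<odot>\<^bsub>free_vs K S\<^esub> v) s \<odot>\<^bsub>U\<^esub> h s)"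
      using c v sub fin by (intro free_eval_superset) auto
    also have "\<dots> = (\<Oplus>\<^bsub>U\<^esub>s\<in>?T v. c \<odot>\<^bsub>U\<^esub> (v s \<odot>\<^bsub>U\<^esub> h s))"
      using u[OF v] hs c by (intro U.finsum_cong') (auto simp: f(4) U.smult_assoc1)
    also have "\<dots> = c \<odot>\<^bsub>U\<^esub> (\<Oplus>\<^bsub>U\<^esub>s\<in>?T v. v s \<odot>\<^bsub>U\<^esub> h s)"
      using u[OF v] hs c fin[OF v] by (intro U.finsum_smult[symmetric]) auto
    finally show ?thesis by (simp add: free_eval_def)
  qed
  show ?thesis
    unfolding LinearCombinations.module_hom_def using cl add smult by auto
qed

lemma free_eval_gen:
  assumes "s \<in> S" shows "free_eval K S U h (free_gen K S s) = h s"
proof -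
  have "free_eval K S U h (free_gen K S s) = (\<Oplus>\<^bsub>U\<^esub>t\<in>{s}. free_gen K S s t \<odot>\<^bsub>U\<^esub> h t)"
    using assms by (intro free_eval_superset free_gen_closed K) (auto simp: free_gen_def)
  also have "\<dots> = h s"
    using assms funcset_mem[OF h assms] by (simp add: free_gen_def)
  finally show ?thesis .
qed

end

lemma bilinear_mapD:
  assumes "bilinear_map K V W U b"
  shows "v \<in> carrier V \<Longrightarrow> w \<in> carrier W \<Longrightarrow> b v w \<in> carrier U"
    "v \<in> carrier V \<Longrightarrow> v' \<in> carrier V \<Longrightarrow> w \<in> carrier W \<Longrightarrow> b (v \<oplus>\<^bsub>V\<^esub> v') w = b v w \<oplus>\<^bsub>U\<^esub> b v' w"
    "v \<in> carrier V \<Longrightarrow> w \<in> carrier W \<Longrightarrow> w' \<in> carrier W \<Longrightarrow> b v (w \<oplus>\<^bsub>W\<^esub> w') = b v w \<oplus>\<^bsub>U\<^esub> b v w'"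
    "c \<in> carrier K \<Longrightarrow> v \<in> carrier V \<Longrightarrow> w \<in> carrier W \<Longrightarrow> b (c \<odot>\<^bsub>V\<^esub> v) w = c \<odot>\<^bsub>U\<^esub> b v w"
    "c \<in> carrier K \<Longrightarrow> v \<in> carrier V \<Longrightarrow> w \<in> carrier W \<Longrightarrow> b v (c \<odot>\<^bsub>W\<^esub> w) = c \<odot>\<^bsub>U\<^esub> b v w"
  using assms unfolding bilinear_map_def LinearCombinations.module_hom_def by auto

context
  fixes K :: "('k, 'r) ring_scheme" and V :: "('k, 'v, 'm) module_scheme"
    and W :: "('k, 'w, 'n) module_scheme" and U :: "('k, 'u, 'p) module_scheme"
    and b :: "'v \<Rightarrow> 'w \<Rightarrow> 'u"
  assumes K: "field K" and V: "module K V" and W: "module K W" and U: "module K U"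
    and b: "bilinear_map K V W U b"
begin

interpretation V: Module.module K V by (rule V)
interpretation W: Module.module K W by (rule W)
interpretation U: Module.module K U by (rule U)
interpretation E: Module.module K "free_vs K (carrier V \<times> carrier W)" by (rule free_vs_module[OF K])

lemma tensor_lift_coset:
  assumes u: "u \<in> carrier (free_vs K (carrier V \<times> carrier W))"
  shows "tensor_lift K V W U b (tensor_null K V W +>\<^bsub>free_vs K (carrier V \<times> carrier W)\<^esub> u) =
    free_eval K (carrier V \<times> carrier W) U (\<lambda>(v, w). b v w) u"
proof -
  let ?S = "carrier V \<times> carrier W"
  let ?E = "free_vs K ?S"
  let ?N = "tensor_null K V W"
  let ?h = "\<lambda>(v, w). b v w"
  note bD = bilinear_mapD[OF b]
  have h: "?h \<in> ?S \<rightarrow> carrier U" using bD(1) by auto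
  note hom = free_eval_hom[OF K U h]
  interpret ev: mod_hom K ?E U "free_eval K ?S U ?h"
    by unfold_locales (rule hom)
  note ev_gen = free_eval_gen[OF K U h]
  have minus: "free_eval K ?S U ?h (x \<ominus>\<^bsub>?E\<^esub> y) =
      free_eval K ?S U ?h x \<ominus>\<^bsub>U\<^esub> free_eval K ?S U ?h y"
    if "x \<in> carrier ?E" "y \<in> carrier ?E" for x y
    using that by (simp add: a_minus_def)
  note g = free_gen_closed[OF K, where S = ?S]
  have sub: "submodule K ev.ker ?E" by (rule ev.ker_is_submodule)
  have "tensor_relations K V W \<subseteq> ev.ker"
    unfolding tensor_relations_def Let_def ev.ker_def
    by (auto simp: minus g ev_gen bD U.r_neg a_minus_def U.r_neg)
  then have "?N \<subseteq> ev.ker"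
    unfolding tensor_null_def by (rule E.span_is_subset[OF _ sub])
  then have ker: "free_eval K ?S U ?h z = \<zero>\<^bsub>U\<^esub>" "z \<in> carrier ?E" if "z \<in> ?N" for z
    using that by (auto simp: ev.ker_def)
  note N = tensor_null_submodule[OF K V W]
  interpret N: submodule K ?N ?E by (rule N)
  have "u = \<zero>\<^bsub>?E\<^esub> \<oplus>\<^bsub>?E\<^esub> u" using u by simp
  then have "u \<in> ?N +>\<^bsub>?E\<^esub> u"
    unfolding a_r_coset_def' using N.zero_closed by blast
  then have "(SOME z. z \<in> ?N +>\<^bsub>?E\<^esub> u) \<in> ?N +>\<^bsub>?E\<^esub> u"
    by (rule someI[where P = "\<lambda>z. z \<in> ?N +>\<^bsub>?E\<^esub> u"])
  then obtain z where z: "z \<in> ?N" "(SOME z. z \<in> ?N +>\<^bsub>?E\<^esub> u) = z \<oplus>\<^bsub>?E\<^esub> u"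
    unfolding a_r_coset_def' by auto
  show ?thesis
    unfolding tensor_lift_def z(2) using ker[OF z(1)] u by simp
qed

lemma tensor_lift_linear: "linear_map K (tensor K V W) U (tensor_lift K V W U b)"
proof -
  let ?S = "carrier V \<times> carrier W"
  have h: "(\<lambda>(v, w). b v w) \<in> ?S \<rightarrow> carrier U" using bilinear_mapD(1)[OF b] by auto
  note E = free_vs_module[OF K, of ?S]
  note N = tensor_null_submodule[OF K V W]
  interpret ev: mod_hom K "free_vs K ?S" U "free_eval K ?S U (\<lambda>(v, w). b v w)"
    by unfold_locales (rule free_eval_hom[OF K U h])
  have "tensor_lift K V W U b \<in> LinearCombinations.module_hom K (tensor K V W) U"
    unfolding LinearCombinations.module_hom_def tensor_def
    by (auto elim!: coset_cases[OF E N] simp: quotient_module_simps[OF E N] tensor_lift_coset)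
  moreover have "vectorspace K (tensor K V W)" by (rule tensor_vectorspace[OF K V W])
  moreover have "vectorspace K U" by (intro vectorspace.intro K U)
  ultimately show ?thesis
    by (auto simp: linear_map_def mod_hom_def mod_hom_axioms_def vectorspace_def)
qed

lemma tensor_lift_pure:
  assumes "v \<in> carrier V" "w \<in> carrier W"
  shows "tensor_lift K V W U b (pure_tensor K V W v w) = b v w"
proof -
  have h: "(\<lambda>(v, w). b v w) \<in> carrier V \<times> carrier W \<rightarrow> carrier U"
    using bilinear_mapD(1)[OF b] by auto
  show ?thesis
    using assms unfolding pure_tensor_def
    by (simp add: tensor_lift_coset free_gen_closed[OF K] free_eval_gen[OF K U h])
qed

end


section \<open>Zero product determined algebras\<close>

text \<open>An algebra over \<open>K\<close> in the sense of a vector space \<open>A\<close> with an arbitrary linear map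
  \<open>\<mu> : A \<otimes> A \<rightarrow> A\<close>; the locale \<open>algebra\<close> of HOL-Algebra is restricted to commutative
  rings. The \<open>mult\<close> field of the record \<open>A\<close> is not used.\<close>

definition nonassoc_algebra ::
  "('k, 'r) ring_scheme \<Rightarrow> ('k, 'a, 'm) module_scheme \<Rightarrow> (('a \<times> 'a \<Rightarrow> 'k) set \<Rightarrow> 'a) \<Rightarrow> bool" where
  "nonassoc_algebra K A \<mu> \<longleftrightarrow> vectorspace K A \<and> linear_map K (tensor K A A) A \<mu>"

definition square_space ::
  "('k, 'r) ring_scheme \<Rightarrow> ('k, 'a, 'm) module_scheme \<Rightarrow> (('a \<times> 'a \<Rightarrow> 'k) set \<Rightarrow> 'a)
    \<Rightarrow> ('k, 'a, 'm) module_scheme" where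
  "square_space K A \<mu> = A\<lparr>carrier := \<mu> ` carrier (tensor K A A)\<rparr>"

text \<open>HOL cannot quantify over types inside a formula, so the type from which the elements of the
  target spaces \<open>X\<close> are taken is a parameter; a theorem with that type left as a type
  variable covers all vector spaces \<open>X\<close>.\<close>

definition zero_product_determined ::
  "'x itself \<Rightarrow> ('k, 'r) ring_scheme \<Rightarrow> ('k, 'a, 'm) module_scheme
    \<Rightarrow> (('a \<times> 'a \<Rightarrow> 'k) set \<Rightarrow> 'a) \<Rightarrow> bool" where
  "zero_product_determined TX K A \<mu> \<longleftrightarrow> nonassoc_algebra K A \<mu> \<and>
     (\<forall>(X :: ('k, 'x) module) \<phi>.
        vectorspace K X \<longrightarrow> linear_map K (tensor K A A) X \<phi> \<longrightarrow>
        (\<forall>x\<in>carrier A. \<forall>y\<in>carrier A.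
           \<mu> (pure_tensor K A A x y) = \<zero>\<^bsub>A\<^esub> \<longrightarrow> \<phi> (pure_tensor K A A x y) = \<zero>\<^bsub>X\<^esub>) \<longrightarrow>
        (\<exists>f. linear_map K (square_space K A \<mu>) X f \<and>
             (\<forall>t\<in>carrier (tensor K A A). \<phi> t = f (\<mu> t))))"


section \<open>Ladder matrices\<close>

definition is_ladder :: "nat \<Rightarrow> nat \<Rightarrow> (nat \<times> nat) set \<Rightarrow> bool" where
  "is_ladder k n L \<longleftrightarrow>
     (\<exists>i j. L = (\<lambda>t. (i t, j t)) ` {1..k} \<and>
            strict_mono_on {1..k} i \<and> i ` {1..k} \<subseteq> {1..n} \<and>
            strict_mono_on {1..k} j \<and> j ` {1..k} \<subseteq> {1..n})"

text \<open>The matrix unit \<open>e\<^bsub>i,j\<^esub>\<close> with indices counted from \<open>1\<close>, whereas the entries of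
  type \<open>mat\<close> are counted from \<open>0\<close>.\<close>

definition mat_unit :: "nat \<Rightarrow> nat \<Rightarrow> nat \<Rightarrow> 'f :: field mat" where
  "mat_unit n i j = mat n n (\<lambda>(a, b). if Suc a = i \<and> Suc b = j then 1 else 0)"

definition ladder_matrices :: "'f :: field itself \<Rightarrow> nat \<Rightarrow> (nat \<times> nat) set \<Rightarrow> ('f, 'f mat) module" where
  "ladder_matrices TF n L = (module_mat TF n n)
     \<lparr>carrier := LinearCombinations.module.span class_ring (module_mat TF n n)
        (\<Union>(p, q)\<in>L. {mat_unit n i j |i j. 1 \<le> i \<and> i \<le> p \<and> q \<le> j \<and> j \<le> n})\<rparr>"

definition ladder_bracket ::
  "'f :: field itself \<Rightarrow> nat \<Rightarrow> (nat \<times> nat) set \<Rightarrow> ('f mat \<times> 'f mat \<Rightarrow> 'f) set \<Rightarrow> 'f mat" where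
  "ladder_bracket TF n L =
     tensor_lift class_ring (ladder_matrices TF n L) (ladder_matrices TF n L)
       (ladder_matrices TF n L) (\<lambda>x y. x * y - y * x)"

lemma is_ladder_1_iff: "is_ladder 1 n {(i, j)} \<longleftrightarrow> 1 \<le> i \<and> i \<le> n \<and> 1 \<le> j \<and> j \<le> n"
proof
  assume "1 \<le> i \<and> i \<le> n \<and> 1 \<le> j \<and> j \<le> n"
  then show "is_ladder 1 n {(i, j)}"
    unfolding is_ladder_def by (intro exI[of _ "\<lambda>_. i"] exI[of _ "\<lambda>_. j"])
      (auto simp: strict_mono_on_def)
qed (auto simp: is_ladder_def)

lemma module_mat_module: "module class_ring (module_mat TYPE('f :: field) n m)"
proof (rule moduleI)
  show "cring (class_ring :: 'f ring)" by (rule field.axioms(1)[THEN domain.axioms(1)], rule class_field)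
qed (auto simp: abelian_group_mat module_mat_simps add_smult_distrib_left_mat
  add_smult_distrib_right_mat intro!: eq_matI)

lemma ladder_generators_closed:
  "(\<Union>(p, q)\<in>L. {mat_unit n i j |i j. 1 \<le> i \<and> i \<le> p \<and> q \<le> j \<and> j \<le> n})
     \<subseteq> carrier (module_mat TYPE('f :: field) n n)"
  by (auto simp: module_mat_simps mat_unit_def)

lemma ladder_matrices_module: "module class_ring (ladder_matrices TYPE('f :: field) n L)"
proof -
  interpret M: Module.module class_ring "module_mat TYPE('f) n n" by (rule module_mat_module)
  show ?thesis
    unfolding ladder_matrices_def
    by (intro M.submodule_is_module M.span_is_submodule ladder_generators_closed)
qed

lemma ladder_matrices_carrier_mat:
  "carrier (ladder_matrices TYPE('f :: field) n L) \<subseteq> carrier_mat n n"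
proof -
  interpret M: Module.module class_ring "module_mat TYPE('f) n n" by (rule module_mat_module)
  show ?thesis
    using M.span_is_subset2[OF ladder_generators_closed]
    unfolding ladder_matrices_def by (simp add: module_mat_simps)
qed

lemma ladder_bracket_linear:
  fixes n :: nat and L :: "(nat \<times> nat) set"
  defines "A \<equiv> ladder_matrices TYPE('f :: field) n L"
  assumes closed: "\<And>x y. x \<in> carrier A \<Longrightarrow> y \<in> carrier A \<Longrightarrow> x * y - y * x \<in> carrier A"
  shows "linear_map class_ring (tensor class_ring A A) A (ladder_bracket TYPE('f) n L)"
    and "x \<in> carrier A \<Longrightarrow> y \<in> carrier A \<Longrightarrow>
      ladder_bracket TYPE('f) n L (pure_tensor class_ring A A x y) = x * y - y * x"
proof -
  have mat: "x \<in> carrier_mat n n" if "x \<in> carrier A" for x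
    using that ladder_matrices_carrier_mat unfolding A_def by blast
  have prod: "x * y \<in> carrier_mat n n" if "x \<in> carrier A" "y \<in> carrier A" for x y
    using that[THEN mat] by simp
  have simps: "add A = (+)" "smult A = (\<cdot>\<^sub>m)"
    by (simp_all add: A_def ladder_matrices_def module_mat_simps)
  have comm: "u - w + (u' - w') = (u + u') - (w + w')"
    if "u \<in> carrier_mat n n" "w \<in> carrier_mat n n" "u' \<in> carrier_mat n n" "w' \<in> carrier_mat n n"
    for u w u' w' :: "'f mat"
    using that by (intro eq_matI) auto
  have scale: "c \<cdot>\<^sub>m u - c \<cdot>\<^sub>m w = c \<cdot>\<^sub>m (u - w)"
    if "u \<in> carrier_mat n n" "w \<in> carrier_mat n n" for c and u w :: "'f mat"
    using that by (intro eq_matI) (auto simp: algebra_simps)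
  have "bilinear_map class_ring A A A (\<lambda>x y. x * y - y * x)"
    unfolding bilinear_map_def LinearCombinations.module_hom_def
    using closed
    by (auto simp: simps comm[OF prod prod prod prod] scale[OF prod prod] add_mult_distrib_mat[OF mat mat mat]
        mult_add_distrib_mat[OF mat mat mat] mult_smult_distrib[OF mat mat]
        mult_smult_assoc_mat[OF mat mat] mat)
  moreover have "module class_ring A" unfolding A_def by (rule ladder_matrices_module)
  ultimately have lift: "field (class_ring :: 'f ring)" "module class_ring A" "module class_ring A"
    "module class_ring A" "bilinear_map class_ring A A A (\<lambda>x y. x * y - y * x)"
    by (simp_all add: class_field)
  show "linear_map class_ring (tensor class_ring A A) A (ladder_bracket TYPE('f) n L)"
    unfolding ladder_bracket_def A_def by (rule tensor_lift_linear[OF lift, unfolded A_def])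
  show "x \<in> carrier A \<Longrightarrow> y \<in> carrier A \<Longrightarrow>
      ladder_bracket TYPE('f) n L (pure_tensor class_ring A A x y) = x * y - y * x"
    unfolding ladder_bracket_def A_def by (rule tensor_lift_pure[OF lift, unfolded A_def])
qed

end

theory Submission
  imports Defs
begin

text \<open>
  Write \<open>p = i\<^sub>1\<close>, \<open>q = j\<^sub>1\<close> and let \<open>b(x, y) = \<phi>(x \<otimes> y)\<close>, a bilinear map that vanishes on
  commuting pairs.  It suffices to find one linear map \<open>f\<close> with \<open>b(x, y) = f([x, y])\<close>, and by
  bilinearity to check this on matrix units \<open>x = e\<^bsub>i,j\<^esub>\<close>, \<open>y = e\<^bsub>k,l\<^esub>\<close>.

  If \<open>p < q\<close>, no column index is a row index, so all products are zero, \<open>b\<close> vanishes and \<open>f = 0\<close>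
  works.  If \<open>q \<le> p\<close>, the indices in \<open>{q..p}\<close> are both row and column indices, and \<open>q\<close> can
  serve as a base point: the candidate is determined by
  \<open>f(e\<^bsub>i,l\<^esub>) = b(e\<^bsub>i,q\<^esub>, e\<^bsub>q,l\<^esub>)\<close> (\<open>factor\<close>).
  That it has the required property rests on three families of commuting pairs:

    \<^item> \<open>e\<^bsub>i,j\<^esub>\<close> and \<open>e\<^bsub>k,l\<^esub>\<close> with \<open>j \<noteq> k\<close>, \<open>i \<noteq> l\<close>, whose products are zero (\<open>b_units_unlinked\<close>);

    \<^item> \<open>e\<^bsub>i,j\<^esub> + e\<^bsub>i,k\<^esub>\<close> and \<open>e\<^bsub>j,l\<^esub> - e\<^bsub>k,l\<^esub>\<close> with \<open>i \<noteq> l\<close>, which show that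
      \<open>b(e\<^bsub>i,j\<^esub>, e\<^bsub>j,l\<^esub>)\<close> does not depend on \<open>j\<close> (\<open>b_units_middle\<close>);

    \<^item> the matrix \<open>e\<^bsub>i,j\<^esub> + e\<^bsub>j,k\<^esub> + e\<^bsub>k,i\<^esub>\<close> of a 3-cycle and its transpose, which show that
      \<open>h(i, j) = b(e\<^bsub>i,j\<^esub>, e\<^bsub>j,i\<^esub>)\<close> satisfies \<open>h(i, j) + h(j, k) + h(k, i) = 0\<close>
      (\<open>b_units_cycle\<close>).

  The last identity makes \<open>h\<close> a coboundary, \<open>h(i, j) = h(i, q) - h(j, q)\<close>
  (\<open>b_units_diagonal\<close>), which matches \<open>[e\<^bsub>i,j\<^esub>, e\<^bsub>j,i\<^esub>] = e\<^bsub>i,i\<^esub> - e\<^bsub>j,j\<^esub>\<close>.  All the relations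
  have coefficients \<open>1\<close> and \<open>-1\<close>, so the argument works in every characteristic.
\<close>

section \<open>Linear maps out of spans and tensor products\<close>

lemma module_homI:
  assumes "\<And>x. x \<in> carrier M \<Longrightarrow> f x \<in> carrier N"
    and "\<And>x y. x \<in> carrier M \<Longrightarrow> y \<in> carrier M \<Longrightarrow> f (x \<oplus>\<^bsub>M\<^esub> y) = f x \<oplus>\<^bsub>N\<^esub> f y"
    and "\<And>c x. c \<in> carrier K \<Longrightarrow> x \<in> carrier M \<Longrightarrow> f (c \<odot>\<^bsub>M\<^esub> x) = c \<odot>\<^bsub>N\<^esub> f x"
  shows "f \<in> LinearCombinations.module_hom K M N"
  using assms unfolding LinearCombinations.module_hom_def by auto

lemma module_hom_comp:
  assumes "f \<in> LinearCombinations.module_hom K M N" "g \<in> LinearCombinations.module_hom K N P"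
  shows "(\<lambda>x. g (f x)) \<in> LinearCombinations.module_hom K M P"
  using assms unfolding LinearCombinations.module_hom_def by (auto simp: Pi_iff)

lemma submodule_equalizer:
  assumes "module K M" "module K N"
    and f: "f \<in> LinearCombinations.module_hom K M N" and g: "g \<in> LinearCombinations.module_hom K M N"
  shows "submodule K {x \<in> carrier M. f x = g x} M"
proof -
  interpret f: mod_hom K M N f using assms by (simp add: mod_hom_def mod_hom_axioms_def)
  interpret g: mod_hom K M N g using assms by (simp add: mod_hom_def mod_hom_axioms_def)
  show ?thesis
    by (unfold_locales) auto
qed

lemma module_hom_eq_on_span:
  assumes M: "module K M" and "module K N"
    and "f \<in> LinearCombinations.module_hom K M N" "g \<in> LinearCombinations.module_hom K M N"
    and "S \<subseteq> carrier M" "\<And>x. x \<in> S \<Longrightarrow> f x = g x"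
    and "x \<in> LinearCombinations.module.span K M S"
  shows "f x = g x"
proof -
  interpret Module.module K M by (rule M)
  show ?thesis
    using span_is_subset[OF _ submodule_equalizer[OF assms(1-4)], of S] assms(5-7) by auto
qed

text \<open>The generators \<open>free_gen K S s\<close> span the free vector space: a finitely supported function
  becomes zero after finitely many multiples of generators have been split off.\<close>

lemma free_vs_eq_submodule:
  assumes K: "field K" and N: "submodule K N (free_vs K S)"
    and gen: "\<And>s. s \<in> S \<Longrightarrow> free_gen K S s \<in> N"
    and u: "u \<in> carrier (free_vs K S)"
  shows "u \<in> N"
proof -
  interpret K: field K by (rule K)
  interpret N: submodule K N "free_vs K S" by (rule N)
  note f = free_vs_simps[OF K.ring_axioms]
  have "u \<in> N" if "finite T" "u \<in> carrier (free_vs K S)" "{s \<in> S. u s \<noteq> \<zero>\<^bsub>K\<^esub>} \<subseteq> T" for T u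
    using that
  proof (induction T arbitrary: u)
    case empty
    then have "u = \<zero>\<^bsub>free_vs K S\<^esub>"
      by (intro ext) (auto simp: f PiE_iff extensional_def)
    then show ?case by simp
  next
    case (insert s T)
    show ?case
    proof (cases "s \<in> S")
      case False
      then show ?thesis using insert by blast
    next
      case True
      define v where "v = u(s := \<zero>\<^bsub>K\<^esub>)"
      have uE: "u \<in> S \<rightarrow>\<^sub>E carrier K" "finite {t \<in> S. u t \<noteq> \<zero>\<^bsub>K\<^esub>}"
        using insert.prems(1) by (simp_all add: f)
      have us: "u s \<in> carrier K" using uE(1) True by blast
      have "{t \<in> S. v t \<noteq> \<zero>\<^bsub>K\<^esub>} \<subseteq> {t \<in> S. u t \<noteq> \<zero>\<^bsub>K\<^esub>}" by (auto simp: v_def)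
      then have "finite {t \<in> S. v t \<noteq> \<zero>\<^bsub>K\<^esub>}"
        using uE(2) by (rule finite_subset)
      moreover have "v \<in> S \<rightarrow>\<^sub>E carrier K"
        using uE(1) True by (auto simp: v_def PiE_iff extensional_def)
      ultimately have "v \<in> carrier (free_vs K S)" by (simp add: f)
      moreover have "{t \<in> S. v t \<noteq> \<zero>\<^bsub>K\<^esub>} \<subseteq> T" using insert.prems(2) by (auto simp: v_def)
      ultimately have "v \<in> N" by (rule insert.IH)
      moreover have "u s \<odot>\<^bsub>free_vs K S\<^esub> free_gen K S s \<in> N"
        using gen[OF True] us by blast
      moreover have "u = v \<oplus>\<^bsub>free_vs K S\<^esub> u s \<odot>\<^bsub>free_vs K S\<^esub> free_gen K S s"
      proof
        fix t
        show "u t = (v \<oplus>\<^bsub>free_vs K S\<^esub> u s \<odot>\<^bsub>free_vs K S\<^esub> free_gen K S s) t"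
          using uE(1) us True by (cases "t \<in> S") (auto simp: f v_def free_gen_def PiE_iff extensional_def)
      qed
      ultimately show ?thesis using N.m_closed by metis
    qed
  qed
  from this[OF _ u order_refl] show ?thesis using u by (simp add: f)
qed

text \<open>The quotient map from the free vector space pulls the two maps back to maps that agree on the
  generators, whose classes are the pure tensors.\<close>

lemma tensor_hom_eqI:
  assumes K: "field K" and V: "module K V" and W: "module K W" and X: "module K X"
    and F: "F \<in> LinearCombinations.module_hom K (tensor K V W) X"
    and G: "G \<in> LinearCombinations.module_hom K (tensor K V W) X"
    and eq: "\<And>v w. v \<in> carrier V \<Longrightarrow> w \<in> carrier W \<Longrightarrow>
      F (pure_tensor K V W v w) = G (pure_tensor K V W v w)"
    and t: "t \<in> carrier (tensor K V W)"
  shows "F t = G t"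
proof -
  let ?S = "carrier V \<times> carrier W"
  let ?E = "free_vs K ?S"
  let ?q = "\<lambda>u. tensor_null K V W +>\<^bsub>?E\<^esub> u"
  note E = free_vs_module[OF K, of ?S]
  note N = tensor_null_submodule[OF K V W]
  have q: "?q \<in> LinearCombinations.module_hom K ?E (tensor K V W)"
    by (rule module_homI) (simp_all add: quotient_module_simps[OF E N, folded tensor_def])
  obtain u where u: "u \<in> carrier ?E" "t = ?q u"
    using coset_cases[OF E N] t unfolding tensor_def by metis
  have "u \<in> {u \<in> carrier ?E. F (?q u) = G (?q u)}"
  proof (rule free_vs_eq_submodule[OF K _ _ u(1)])
    show "submodule K {u \<in> carrier ?E. F (?q u) = G (?q u)} ?E"
      by (intro submodule_equalizer[OF E X] module_hom_comp[OF q] F G)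
    show "free_gen K ?S s \<in> {u \<in> carrier ?E. F (?q u) = G (?q u)}" if "s \<in> ?S" for s
      using that eq free_gen_closed[OF K that] unfolding pure_tensor_def by auto
  qed
  then show ?thesis using u(2) by simp
qed

lemma bilinear_map_pure_tensor:
  assumes "field K" "module K V" "module K W"
    and F: "F \<in> LinearCombinations.module_hom K (tensor K V W) X"
  shows "bilinear_map K V W X (\<lambda>v w. F (pure_tensor K V W v w))"
  unfolding bilinear_map_def
proof (intro conjI ballI)
  note p = pure_tensor_bilinear[OF assms(1-3), unfolded bilinear_map_def]
  show "(\<lambda>w. F (pure_tensor K V W v w)) \<in> LinearCombinations.module_hom K W X"
    if "v \<in> carrier V" for v
    by (rule module_hom_comp[OF bspec[OF conjunct1[OF p] that] F])
  show "(\<lambda>v. F (pure_tensor K V W v w)) \<in> LinearCombinations.module_hom K V X"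
    if "w \<in> carrier W" for w
    by (rule module_hom_comp[OF bspec[OF conjunct2[OF p] that] F])
qed

lemma bilinear_map_eq_on_span:
  assumes V: "module K V" and W: "module K W" and X: "module K X"
    and b: "bilinear_map K V W X b" and b': "bilinear_map K V W X b'"
    and S: "S \<subseteq> carrier V" "carrier V \<subseteq> LinearCombinations.module.span K V S"
    and T: "T \<subseteq> carrier W" "carrier W \<subseteq> LinearCombinations.module.span K W T"
    and eq: "\<And>v w. v \<in> S \<Longrightarrow> w \<in> T \<Longrightarrow> b v w = b' v w"
    and v: "v \<in> carrier V" and w: "w \<in> carrier W"
  shows "b v w = b' v w"
proof (rule module_hom_eq_on_span[OF V X _ _ S(1)])
  show "(\<lambda>v. b v w) \<in> LinearCombinations.module_hom K V X"
    "(\<lambda>v. b' v w) \<in> LinearCombinations.module_hom K V X"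
    using b b' w by (simp_all add: bilinear_map_def)
  show "v \<in> LinearCombinations.module.span K V S" using S(2) v by blast
  show "b v w = b' v w" if "v \<in> S" for v
  proof (rule module_hom_eq_on_span[OF W X _ _ T(1)])
    have "v \<in> carrier V" using S(1) that by blast
    then show "b v \<in> LinearCombinations.module_hom K W X"
      "b' v \<in> LinearCombinations.module_hom K W X"
      using b b' by (simp_all add: bilinear_map_def)
    show "w \<in> LinearCombinations.module.span K W T" using T(2) w by blast
    show "b v w = b' v w" if "w \<in> T" for w
      using \<open>v \<in> S\<close> that by (rule eq)
  qed
qed

text \<open>Reduces the tensor formulation to bilinear maps.  The map \<open>f\<close> may be given on all of \<open>A\<close>,
  since only its restriction to the image of \<open>\<mu>\<close> matters.\<close>

lemma zero_product_determinedI: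
  fixes A :: "('k, 'a, 'm) module_scheme"
  assumes K: "field K" and alg: "nonassoc_algebra K A \<mu>"
    and factor: "\<And>(X :: ('k, 'x) module) b. module K X \<Longrightarrow> bilinear_map K A A X b \<Longrightarrow>
      (\<And>x y. x \<in> carrier A \<Longrightarrow> y \<in> carrier A \<Longrightarrow>
        \<mu> (pure_tensor K A A x y) = \<zero>\<^bsub>A\<^esub> \<Longrightarrow> b x y = \<zero>\<^bsub>X\<^esub>) \<Longrightarrow>
      \<exists>f \<in> LinearCombinations.module_hom K A X. \<forall>x\<in>carrier A. \<forall>y\<in>carrier A.
        b x y = f (\<mu> (pure_tensor K A A x y))"
  shows "zero_product_determined TYPE('x) K A \<mu>"
  unfolding zero_product_determined_def
proof (intro conjI allI impI alg)
  fix X :: "('k, 'x) module" and \<phi>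
  assume X: "vectorspace K X" and \<phi>: "linear_map K (tensor K A A) X \<phi>"
    and zero: "\<forall>x\<in>carrier A. \<forall>y\<in>carrier A.
      \<mu> (pure_tensor K A A x y) = \<zero>\<^bsub>A\<^esub> \<longrightarrow> \<phi> (pure_tensor K A A x y) = \<zero>\<^bsub>X\<^esub>"
  interpret \<phi>: mod_hom K "tensor K A A" X \<phi> using \<phi> by (simp add: linear_map_def)
  interpret \<mu>: mod_hom K "tensor K A A" A \<mu>
    using alg by (simp add: nonassoc_algebra_def linear_map_def)
  have A: "module K A" and X': "module K X"
    using X alg by (simp_all add: nonassoc_algebra_def vectorspace_def)
  obtain f where f: "f \<in> LinearCombinations.module_hom K A X"
    and eq: "\<And>x y. x \<in> carrier A \<Longrightarrow> y \<in> carrier A \<Longrightarrow>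
      \<phi> (pure_tensor K A A x y) = f (\<mu> (pure_tensor K A A x y))"
    using factor[OF X' bilinear_map_pure_tensor[OF K A A \<phi>.f_hom]] zero by blast
  have "square_space K A \<mu> = A\<lparr>carrier := \<mu>.im\<rparr>" by (simp add: square_space_def \<mu>.im_def)
  then have sq: "module K (square_space K A \<mu>)"
    using \<mu>.N.submodule_is_module[OF \<mu>.im_is_submodule] by simp
  have "f \<in> LinearCombinations.module_hom K (square_space K A \<mu>) X"
    using f \<mu>.f_im unfolding LinearCombinations.module_hom_def square_space_def by auto
  then have "linear_map K (square_space K A \<mu>) X f"
    using sq X X' K by (simp add: linear_map_def mod_hom_def mod_hom_axioms_def vectorspace_def)
  moreover have "\<phi> t = f (\<mu> t)" if "t \<in> carrier (tensor K A A)" for t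
    using tensor_hom_eqI[OF K A A X' \<phi>.f_hom module_hom_comp[OF \<mu>.f_hom f]] eq that by blast
  ultimately show "\<exists>f. linear_map K (square_space K A \<mu>) X f \<and>
      (\<forall>t\<in>carrier (tensor K A A). \<phi> t = f (\<mu> t))" by blast
qed

section \<open>Matrices of a one-step ladder\<close>

lemma mat_unit_mult:
  assumes "1 \<le> j" "j \<le> n"
  shows "mat_unit n i j * mat_unit n k l = (if j = k then mat_unit n i l else 0\<^sub>m n n)"
proof (rule eq_matI)
  fix r s assume "r < dim_row (if j = k then mat_unit n i l else 0\<^sub>m n n :: 'a mat)"
    and "s < dim_col (if j = k then mat_unit n i l else 0\<^sub>m n n :: 'a mat)"
  then have rs: "r < n" "s < n" by (auto simp: mat_unit_def split: if_splits)
  have "(mat_unit n i j * mat_unit n k l :: 'a mat) $$ (r, s) =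
      (\<Sum>a<n. mat_unit n i j $$ (r, a) * mat_unit n k l $$ (a, s))"
    using rs by (simp add: mat_unit_def scalar_prod_def lessThan_atLeast0)
  also have "\<dots> =
      (\<Sum>a<n. if a = j - 1 then (if Suc r = i \<and> j = k \<and> Suc s = l then 1 else 0) else 0)"
    using rs assms by (intro sum.cong) (auto simp: mat_unit_def)
  also have "\<dots> = (if j = k then mat_unit n i l else 0\<^sub>m n n) $$ (r, s)"
    using rs assms by (auto simp: mat_unit_def)
  finally show "(mat_unit n i j * mat_unit n k l) $$ (r, s) =
    (if j = k then mat_unit n i l else 0\<^sub>m n n :: 'a mat) $$ (r, s)" .
qed (auto simp: mat_unit_def)

lemma mat_unit_carrier [simp]: "mat_unit n i j \<in> carrier_mat n n"
  by (simp add: mat_unit_def)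

text \<open>The parameter \<open>TF\<close> makes the field of matrix entries the same for all facts of the locale.\<close>

locale one_step_ladder =
  fixes TF :: "'f :: field itself" and n p q :: nat
  assumes ladder: "is_ladder 1 n {(p, q)}"
begin

abbreviation E :: "nat \<Rightarrow> nat \<Rightarrow> 'f mat" where "E \<equiv> mat_unit n"

abbreviation A :: "('f, 'f mat) module" where
  "A \<equiv> ladder_matrices TYPE('f) n {(p, q)}"

abbreviation units :: "'f mat set" where
  "units \<equiv> {E i j |i j. 1 \<le> i \<and> i \<le> p \<and> q \<le> j \<and> j \<le> n}"

lemma bounds: "1 \<le> p" "p \<le> n" "1 \<le> q" "q \<le> n"
  using ladder unfolding is_ladder_1_iff by simp_all

lemma A_module: "module class_ring A"
  by (rule ladder_matrices_module)

lemma A_simps: "add A = (+)" "smult A = (\<cdot>\<^sub>m)" "\<zero>\<^bsub>A\<^esub> = 0\<^sub>m n n"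
  by (simp_all add: ladder_matrices_def module_mat_simps)

lemma A_mat: "x \<in> carrier A \<Longrightarrow> x \<in> carrier_mat n n"
  using ladder_matrices_carrier_mat by blast

lemma units_subset: "units \<subseteq> carrier A"
proof -
  interpret M: Module.module class_ring "module_mat TYPE('f) n n" by (rule module_mat_module)
  show ?thesis
    using M.in_own_span[OF ladder_generators_closed[of n "{(p, q)}"]]
    by (simp add: ladder_matrices_def)
qed

lemma unit_in_A: "1 \<le> i \<Longrightarrow> i \<le> p \<Longrightarrow> q \<le> j \<Longrightarrow> j \<le> n \<Longrightarrow> E i j \<in> carrier A"
  using units_subset by blast

text \<open>By definition the ladder matrices are the span inside the module of all matrices; spans do not
  depend on the ambient module, so the units also span \<open>A\<close> as a module of its own.\<close>

lemma A_subset_span: "carrier A \<subseteq> LinearCombinations.module.span class_ring A units"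
proof -
  interpret M: Module.module class_ring "module_mat TYPE('f) n n" by (rule module_mat_module)
  note g = ladder_generators_closed[of n "{(p, q)}", where 'f = 'f]
  have "LinearCombinations.module.span class_ring (M.md (M.span units)) units = M.span units"
    using M.span_li_not_depend(1)[OF M.in_own_span M.span_is_submodule] g by simp
  then show ?thesis by (simp add: ladder_matrices_def)
qed

lemma A_closed:
  "x \<in> carrier A \<Longrightarrow> y \<in> carrier A \<Longrightarrow> x + y \<in> carrier A"
  "x \<in> carrier A \<Longrightarrow> c \<cdot>\<^sub>m x \<in> carrier A"
  "0\<^sub>m n n \<in> carrier A"
proof -
  interpret A: Module.module class_ring A by (rule A_module)
  show "x \<in> carrier A \<Longrightarrow> y \<in> carrier A \<Longrightarrow> x + y \<in> carrier A" for x y :: "'f mat"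
    using A.add.m_closed by (simp add: A_simps)
  show "x \<in> carrier A \<Longrightarrow> c \<cdot>\<^sub>m x \<in> carrier A" for x :: "'f mat" and c
    using A.smult_closed[of c x] by (simp add: A_simps class_ring_simps)
  show "(0\<^sub>m n n :: 'f mat) \<in> carrier A"
    using A.zero_closed by (simp add: A_simps)
qed

lemma A_induct [consumes 1, case_names zero add smult unit]:
  fixes x :: "'f mat"
  assumes x: "x \<in> carrier A"
    and "P (0\<^sub>m n n)"
    and "\<And>x y. x \<in> carrier A \<Longrightarrow> y \<in> carrier A \<Longrightarrow> P x \<Longrightarrow> P y \<Longrightarrow> P (x + y)"
    and "\<And>c x. x \<in> carrier A \<Longrightarrow> P x \<Longrightarrow> P (c \<cdot>\<^sub>m x)"
    and "\<And>i j. 1 \<le> i \<Longrightarrow> i \<le> p \<Longrightarrow> q \<le> j \<Longrightarrow> j \<le> n \<Longrightarrow> P (E i j)"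
  shows "P x"
proof -
  interpret A: Module.module class_ring A by (rule A_module)
  have "submodule class_ring {x \<in> carrier A. P x} A"
    by (rule submodule.intro[OF A_module])
      (use assms(2-4) A_closed in \<open>auto simp: A_simps\<close>)
  moreover have "units \<subseteq> {x \<in> carrier A. P x}" using assms(5) unit_in_A by auto
  ultimately show ?thesis using A.span_is_subset A_subset_span x by blast
qed

lemma mult_closed:
  fixes x y :: "'f mat"
  assumes "x \<in> carrier A" "y \<in> carrier A"
  shows "x * y \<in> carrier A"
  using assms
proof (induction x arbitrary: y rule: A_induct)
  case zero
  then show ?case using A_mat A_closed(3) by (metis left_mult_zero_mat)
next
  case (add x y z)
  then show ?case using A_closed(1) by (simp add: add_mult_distrib_mat[OF A_mat A_mat A_mat])
next
  case (smult c x)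
  then show ?case using A_closed(2) by (simp add: mult_smult_assoc_mat[OF A_mat A_mat])
next
  case (unit i j)
  note ij = unit(1-4)
  have Eij: "E i j \<in> carrier A" using ij by (rule unit_in_A)
  from unit(5) show ?case
  proof (induction y rule: A_induct)
    case zero
    show ?case using A_closed(3) by (simp add: right_mult_zero_mat[OF A_mat[OF Eij]])
  next
    case (add x y)
    then show ?case using A_closed(1) by (simp add: mult_add_distrib_mat[OF A_mat[OF Eij] A_mat A_mat])
  next
    case (smult c x)
    then show ?case using A_closed(2) by (simp add: mult_smult_distrib[OF A_mat[OF Eij] A_mat])
  next
    case (unit k l)
    then show ?case using ij bounds A_closed(3) by (simp add: mat_unit_mult unit_in_A)
  qed
qed

lemma commutator_closed:
  fixes x y :: "'f mat"
  assumes "x \<in> carrier A" "y \<in> carrier A"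
  shows "x * y - y * x \<in> carrier A"
proof -
  have "x * y + (- 1) \<cdot>\<^sub>m (y * x) \<in> carrier A"
    using assms by (intro A_closed mult_closed)
  also have "x * y + (- 1) \<cdot>\<^sub>m (y * x) = x * y - y * x"
    using assms[THEN A_mat] by (intro eq_matI) auto
  finally show ?thesis .
qed

end

section \<open>Bilinear maps that vanish on commuting pairs\<close>

locale commutator_factor = one_step_ladder TF n p q
  for TF :: "'f :: field itself" and n p q :: nat +
  fixes X :: "('f, 'x) module" and b :: "'f mat \<Rightarrow> 'f mat \<Rightarrow> 'x"
  assumes X_module: "module class_ring X"
    and bilinear: "bilinear_map class_ring A A X b"
    and commuting: "x \<in> carrier A \<Longrightarrow> y \<in> carrier A \<Longrightarrow> x * y = y * x \<Longrightarrow> b x y = \<zero>\<^bsub>X\<^esub>"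
begin

interpretation X: Module.module class_ring X by (rule X_module)

lemmas b_closed = bilinear_mapD(1)[OF bilinear]
lemmas b_add_left = bilinear_mapD(2)[OF bilinear, unfolded A_simps]
lemmas b_add_right = bilinear_mapD(3)[OF bilinear, unfolded A_simps]

lemma b_minus_right:
  assumes "x \<in> carrier A" "y \<in> carrier A"
  shows "b x ((- 1) \<cdot>\<^sub>m y) = \<ominus>\<^bsub>X\<^esub> b x y"
proof -
  have "b x ((- 1) \<cdot>\<^sub>m y) = (- 1) \<odot>\<^bsub>X\<^esub> b x y"
    using bilinear_mapD(5)[OF bilinear, of "- 1" x y] assms by (simp add: A_simps class_ring_simps)
  also have "\<dots> = \<ominus>\<^bsub>X\<^esub> b x y"
    using X.smult_l_minus[of 1 "b x y"] X.smult_one[of "b x y"] b_closed[OF assms]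
    by (simp add: class_ring_simps)
  finally show ?thesis .
qed

text \<open>Every matrix commutes with itself, so \<open>b\<close> is alternating; polarisation gives the sign
  rule.\<close>

lemma b_skew:
  assumes x: "x \<in> carrier A" and y: "y \<in> carrier A"
  shows "b x y = \<ominus>\<^bsub>X\<^esub> b y x"
proof -
  have "\<zero>\<^bsub>X\<^esub> = b (x + y) (x + y)" using A_closed(1)[OF x y] by (simp add: commuting)
  also have "\<dots> = b x y \<oplus>\<^bsub>X\<^esub> b y x"
    using x y commuting[OF x x] commuting[OF y y]
    by (simp add: b_add_left b_add_right A_closed b_closed X.a_comm)
  finally show ?thesis using X.minus_equality[of "b x y" "b y x"] x y b_closed by simp
qed

text \<open>Both products of the two matrix units are zero.\<close>

lemma b_units_unlinked:
  assumes "1 \<le> i" "i \<le> p" "q \<le> j" "j \<le> n" "1 \<le> k" "k \<le> p" "q \<le> l" "l \<le> n" "j \<noteq> k" "i \<noteq> l"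
  shows "b (E i j) (E k l) = \<zero>\<^bsub>X\<^esub>"
  using assms bounds by (intro commuting) (auto simp: unit_in_A mat_unit_mult)

text \<open>Expand \<open>b\<close> on the commuting pair \<open>e\<^bsub>i,j\<^esub> + e\<^bsub>i,k\<^esub>\<close>, \<open>e\<^bsub>j,l\<^esub> - e\<^bsub>k,l\<^esub>\<close>: both products are
  zero, because the terms \<open>e\<^bsub>i,l\<^esub>\<close> cancel in one order and nothing meets in the other.  The two
  mixed terms of the expansion vanish by \<open>b_units_unlinked\<close>.\<close>

lemma b_units_middle:
  assumes i: "1 \<le> i" "i \<le> p" and l: "q \<le> l" "l \<le> n" and il: "i \<noteq> l"
    and j: "q \<le> j" "j \<le> p" and k: "q \<le> k" "k \<le> p"
  shows "b (E i j) (E j l) = b (E i k) (E k l)"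
proof (cases "j = k")
  case False
  have le: "j \<le> n" "k \<le> n" "1 \<le> j" "1 \<le> k" "1 \<le> l" using bounds j k l by auto
  have in_A: "E i j \<in> carrier A" "E i k \<in> carrier A" "E j l \<in> carrier A" "E k l \<in> carrier A"
    using i j k l le by (auto intro: unit_in_A)
  let ?x = "E i j + E i k" and ?y = "E j l + (- 1) \<cdot>\<^sub>m E k l"
  have xy_A: "?x \<in> carrier A" "(- 1) \<cdot>\<^sub>m E k l \<in> carrier A" "?y \<in> carrier A"
    using in_A by (auto intro: A_closed)
  have "?x * ?y = E i l + (- 1) \<cdot>\<^sub>m E i l"
    using False le i l il
    by (simp add: add_mult_distrib_mat[of _ n n _ _ n] mult_add_distrib_mat[of _ n n _ n]
        mult_smult_distrib[of _ n n _ n] mat_unit_mult)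
  moreover have "?y * ?x = 0\<^sub>m n n"
    using False le i l il
    by (simp add: add_mult_distrib_mat[of _ n n _ _ n] mult_add_distrib_mat[of _ n n _ n]
        mult_smult_assoc_mat[of _ n n _ n] mat_unit_mult)
  moreover have "E i l + (- 1) \<cdot>\<^sub>m E i l = 0\<^sub>m n n"
    by (intro eq_matI) (auto simp: mat_unit_def)
  ultimately have "b ?x ?y = \<zero>\<^bsub>X\<^esub>" using xy_A by (intro commuting) auto
  moreover have "b (E i j) (E k l) = \<zero>\<^bsub>X\<^esub>" "b (E i k) (E j l) = \<zero>\<^bsub>X\<^esub>"
    using False i j k l il le by (auto intro!: b_units_unlinked)
  ultimately have "b (E i j) (E j l) \<ominus>\<^bsub>X\<^esub> b (E i k) (E k l) = \<zero>\<^bsub>X\<^esub>"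
    using in_A xy_A by (simp add: b_add_left b_add_right b_minus_right b_closed a_minus_def)
  then show ?thesis using in_A by (simp add: b_closed)
qed simp

text \<open>The permutation matrix of the cycle \<open>(i j k)\<close>, restricted to these three indices, commutes with
  its inverse.  Of the nine terms of the expansion, the six off the diagonal vanish by
  \<open>b_units_unlinked\<close>.\<close>

lemma b_units_cycle:
  assumes i: "q \<le> i" "i \<le> p" and j: "q \<le> j" "j \<le> p" and k: "q \<le> k" "k \<le> p"
    and distinct: "i \<noteq> j" "j \<noteq> k" "i \<noteq> k"
  shows "b (E i j) (E j i) \<oplus>\<^bsub>X\<^esub> b (E j k) (E k j) \<oplus>\<^bsub>X\<^esub> b (E k i) (E i k) = \<zero>\<^bsub>X\<^esub>"
proof -
  have le: "i \<le> n" "j \<le> n" "k \<le> n" "1 \<le> i" "1 \<le> j" "1 \<le> k" using bounds i j k by auto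
  have in_A: "E i j \<in> carrier A" "E j i \<in> carrier A" "E j k \<in> carrier A" "E k j \<in> carrier A"
    "E k i \<in> carrier A" "E i k \<in> carrier A"
    using i j k le by (auto intro: unit_in_A)
  let ?x = "E i j + E j k + E k i" and ?y = "E j i + E k j + E i k"
  have xy_A: "E i j + E j k \<in> carrier A" "E j i + E k j \<in> carrier A" "?x \<in> carrier A" "?y \<in> carrier A"
    using in_A by (auto intro: A_closed)
  have "?x * ?y = E i i + E j j + E k k"
    using distinct le
    by (simp add: add_mult_distrib_mat[of _ n n _ _ n] mult_add_distrib_mat[of _ n n _ n] mat_unit_mult)
  moreover have "?y * ?x = E j j + E k k + E i i"
    using distinct le
    by (simp add: add_mult_distrib_mat[of _ n n _ _ n] mult_add_distrib_mat[of _ n n _ n] mat_unit_mult)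
  moreover have "E i i + E j j + E k k = E j j + E k k + E i i"
    by (intro eq_matI) (auto simp: mat_unit_def)
  ultimately have "b ?x ?y = \<zero>\<^bsub>X\<^esub>" using xy_A by (intro commuting) auto
  moreover have "b (E i j) (E k j) = \<zero>\<^bsub>X\<^esub>" "b (E i j) (E i k) = \<zero>\<^bsub>X\<^esub>"
    "b (E j k) (E j i) = \<zero>\<^bsub>X\<^esub>" "b (E j k) (E i k) = \<zero>\<^bsub>X\<^esub>"
    "b (E k i) (E j i) = \<zero>\<^bsub>X\<^esub>" "b (E k i) (E k j) = \<zero>\<^bsub>X\<^esub>"
    using distinct i j k le by (auto intro!: b_units_unlinked)
  ultimately show ?thesis
    using in_A xy_A by (simp add: b_add_left b_add_right b_closed)
qed

text \<open>The linear extension of \<open>e\<^bsub>i,l\<^esub> \<mapsto> b(e\<^bsub>i,q\<^esub>, e\<^bsub>q,l\<^esub>)\<close>; indices are shifted by one because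
  matrix entries are counted from \<open>0\<close>.\<close>

definition factor :: "'f mat \<Rightarrow> 'x" where
  "factor M = (\<Oplus>\<^bsub>X\<^esub>s\<in>{1..p} \<times> {q..n}.
     M $$ (fst s - 1, snd s - 1) \<odot>\<^bsub>X\<^esub> b (E (fst s) q) (E q (snd s)))"

text \<open>If \<open>q \<le> p\<close>, both \<open>e\<^bsub>i,q\<^esub>\<close> and \<open>e\<^bsub>q,l\<^esub>\<close> are ladder matrices, which makes \<open>factor\<close> meaningful.\<close>

context
  assumes qp: "q \<le> p"
begin

lemma factor_term_closed:
  "s \<in> {1..p} \<times> {q..n} \<Longrightarrow> b (E (fst s) q) (E q (snd s)) \<in> carrier X"
  using bounds qp by (auto intro!: b_closed unit_in_A)

lemma factor_hom: "factor \<in> LinearCombinations.module_hom class_ring A X"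
proof (rule module_homI)
  note cl = factor_term_closed
  have ix: "fst s - 1 < n" "snd s - 1 < n" if "s \<in> {1..p} \<times> {q..n}" for s
    using that bounds by auto
  show "factor M \<in> carrier X" for M
    unfolding factor_def using cl by (intro X.finsum_closed) (auto simp: class_ring_simps)
  show "factor (M \<oplus>\<^bsub>A\<^esub> N) = factor M \<oplus>\<^bsub>X\<^esub> factor N" if "M \<in> carrier A" "N \<in> carrier A" for M N
  proof -
    have "factor (M \<oplus>\<^bsub>A\<^esub> N) = (\<Oplus>\<^bsub>X\<^esub>s\<in>{1..p} \<times> {q..n}.
        M $$ (fst s - 1, snd s - 1) \<odot>\<^bsub>X\<^esub> b (E (fst s) q) (E q (snd s)) \<oplus>\<^bsub>X\<^esub>
        N $$ (fst s - 1, snd s - 1) \<odot>\<^bsub>X\<^esub> b (E (fst s) q) (E q (snd s)))"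
      unfolding factor_def
    proof (rule X.finsum_cong')
      fix s assume s: "s \<in> {1..p} \<times> {q..n}"
      show "(M \<oplus>\<^bsub>A\<^esub> N) $$ (fst s - 1, snd s - 1) \<odot>\<^bsub>X\<^esub> b (E (fst s) q) (E q (snd s)) =
        M $$ (fst s - 1, snd s - 1) \<odot>\<^bsub>X\<^esub> b (E (fst s) q) (E q (snd s)) \<oplus>\<^bsub>X\<^esub>
        N $$ (fst s - 1, snd s - 1) \<odot>\<^bsub>X\<^esub> b (E (fst s) q) (E q (snd s))"
        using ix[OF s] that[THEN A_mat] cl[OF s]
          X.smult_l_distr[of "M $$ (fst s - 1, snd s - 1)" "N $$ (fst s - 1, snd s - 1)"
            "b (E (fst s) q) (E q (snd s))"]
        by (simp add: A_simps class_ring_simps)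
    qed (use cl in \<open>auto simp: class_ring_simps\<close>)
    also have "\<dots> = factor M \<oplus>\<^bsub>X\<^esub> factor N"
      unfolding factor_def using cl by (intro X.finsum_addf) (auto simp: class_ring_simps)
    finally show ?thesis .
  qed
  show "factor (c \<odot>\<^bsub>A\<^esub> M) = c \<odot>\<^bsub>X\<^esub> factor M" if "M \<in> carrier A" for c M
  proof -
    have "factor (c \<odot>\<^bsub>A\<^esub> M) = (\<Oplus>\<^bsub>X\<^esub>s\<in>{1..p} \<times> {q..n}.
        c \<odot>\<^bsub>X\<^esub> (M $$ (fst s - 1, snd s - 1) \<odot>\<^bsub>X\<^esub> b (E (fst s) q) (E q (snd s))))"
      unfolding factor_def
    proof (rule X.finsum_cong')
      fix s assume s: "s \<in> {1..p} \<times> {q..n}"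
      show "(c \<odot>\<^bsub>A\<^esub> M) $$ (fst s - 1, snd s - 1) \<odot>\<^bsub>X\<^esub> b (E (fst s) q) (E q (snd s)) =
        c \<odot>\<^bsub>X\<^esub> (M $$ (fst s - 1, snd s - 1) \<odot>\<^bsub>X\<^esub> b (E (fst s) q) (E q (snd s)))"
        using ix[OF s] A_mat[OF that] cl[OF s]
          X.smult_assoc1[of c "M $$ (fst s - 1, snd s - 1)" "b (E (fst s) q) (E q (snd s))"]
        by (simp add: A_simps class_ring_simps)
    qed (use cl in \<open>auto simp: class_ring_simps\<close>)
    also have "\<dots> = c \<odot>\<^bsub>X\<^esub> factor M"
      unfolding factor_def using cl
      by (intro X.finsum_smult[symmetric]) (auto simp: class_ring_simps)
    finally show ?thesis .
  qed
qed

lemma factor_unit: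
  assumes "1 \<le> i" "i \<le> p" "q \<le> l" "l \<le> n"
  shows "factor (E i l) = b (E i q) (E q l)"
proof -
  have "factor (E i l) = (\<Oplus>\<^bsub>X\<^esub>s\<in>{1..p} \<times> {q..n}.
      if (i, l) = s then b (E (fst s) q) (E q (snd s)) else \<zero>\<^bsub>X\<^esub>)"
    unfolding factor_def
  proof (rule X.finsum_cong')
    fix s assume s: "s \<in> {1..p} \<times> {q..n}"
    then have "E i l $$ (fst s - 1, snd s - 1) = (if (i, l) = s then 1 else 0)"
      using bounds by (auto simp: mat_unit_def split: if_splits)
    then show "E i l $$ (fst s - 1, snd s - 1) \<odot>\<^bsub>X\<^esub> b (E (fst s) q) (E q (snd s)) =
        (if (i, l) = s then b (E (fst s) q) (E q (snd s)) else \<zero>\<^bsub>X\<^esub>)"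
      using factor_term_closed[OF s] X.smult_one[of "b (E (fst s) q) (E q (snd s))"]
        X.smult_l_null[of "b (E (fst s) q) (E q (snd s))"]
      by (simp add: class_ring_simps)
  qed (use factor_term_closed in auto)
  also have "\<dots> = b (E (fst (i, l)) q) (E q (snd (i, l)))"
    using assms factor_term_closed by (intro X.finsum_singleton) auto
  finally show ?thesis by simp
qed

lemma factor_minus:
  assumes "M \<in> carrier A" "N \<in> carrier A"
  shows "factor (M - N) = factor M \<ominus>\<^bsub>X\<^esub> factor N"
proof -
  interpret mod_hom class_ring A X factor
    using A_module X_module factor_hom by (simp add: mod_hom_def mod_hom_axioms_def)
  have "M - N = M + (- 1) \<cdot>\<^sub>m N"
    using assms[THEN A_mat] by (intro eq_matI) auto
  also have "factor \<dots> = factor M \<oplus>\<^bsub>X\<^esub> (- 1) \<odot>\<^bsub>X\<^esub> factor N"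
    using f_add[of M "(- 1) \<cdot>\<^sub>m N"] f_smult[of "- 1" N] assms A_closed(2)[of N "- 1"]
    by (simp add: A_simps class_ring_simps)
  also have "(- 1) \<odot>\<^bsub>X\<^esub> factor N = \<ominus>\<^bsub>X\<^esub> factor N"
    using X.smult_l_minus[of 1 "factor N"] X.smult_one[of "factor N"] f_im[OF assms(2)]
    by (simp add: class_ring_simps)
  finally show ?thesis by (simp add: a_minus_def)
qed

lemma factor_zero: "factor (0\<^sub>m n n) = \<zero>\<^bsub>X\<^esub>"
proof -
  interpret mod_hom class_ring A X factor
    using A_module X_module factor_hom by (simp add: mod_hom_def mod_hom_axioms_def)
  show ?thesis using f0_is_0 by (simp add: A_simps)
qed

text \<open>The case of three distinct indices is \<open>b_units_cycle\<close> with third index \<open>q\<close>; the degenerate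
  cases only use that \<open>b\<close> is alternating.\<close>

lemma b_units_diagonal:
  assumes i: "q \<le> i" "i \<le> p" and j: "q \<le> j" "j \<le> p"
  shows "b (E i j) (E j i) = b (E i q) (E q i) \<ominus>\<^bsub>X\<^esub> b (E j q) (E q j)"
proof -
  have le: "1 \<le> i" "1 \<le> j" "1 \<le> q" "i \<le> n" "j \<le> n" "q \<le> n" using bounds i j by auto
  have in_A: "E r s \<in> carrier A" if "r \<in> {i, j, q}" "s \<in> {i, j, q}" for r s
    using that i j qp le by (auto intro!: unit_in_A)
  have cl: "b (E r s) (E s r) \<in> carrier X" if "r \<in> {i, j, q}" "s \<in> {i, j, q}" for r s
    using that in_A by (auto intro!: b_closed)
  have skew: "b (E r s) (E s r) = \<ominus>\<^bsub>X\<^esub> b (E s r) (E r s)" if "r \<in> {i, j, q}" "s \<in> {i, j, q}" for r s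
    using that in_A by (intro b_skew) auto
  have self: "b (E r r) (E r r) = \<zero>\<^bsub>X\<^esub>" if "r \<in> {i, j, q}" for r
    using that in_A by (intro commuting) auto
  consider "i = j" | "i = q" | "j = q" | "i \<noteq> j" "j \<noteq> q" "i \<noteq> q" by blast
  then show ?thesis
  proof cases
    case 1
    then show ?thesis using self[of j] cl[of j q] by (simp add: X.r_neg a_minus_def)
  next
    case 2
    then show ?thesis using self[of q] cl[of j q] skew[of q j] by (simp add: a_minus_def)
  next
    case 3
    then show ?thesis using self[of q] cl[of i q] by (simp add: a_minus_def)
  next
    case 4
    have "b (E i j) (E j i) \<oplus>\<^bsub>X\<^esub> b (E j q) (E q j) \<ominus>\<^bsub>X\<^esub> b (E i q) (E q i) = \<zero>\<^bsub>X\<^esub>"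
      using b_units_cycle[OF i j _ qp 4] skew[of q i] by (simp add: a_minus_def)
    then have "b (E i j) (E j i) \<oplus>\<^bsub>X\<^esub> b (E j q) (E q j) = b (E i q) (E q i)"
      using cl by simp
    then have "b (E i q) (E q i) \<ominus>\<^bsub>X\<^esub> b (E j q) (E q j) =
        (b (E i j) (E j i) \<oplus>\<^bsub>X\<^esub> b (E j q) (E q j)) \<ominus>\<^bsub>X\<^esub> b (E j q) (E q j)" by simp
    also have "\<dots> = b (E i j) (E j i)"
      using cl by (simp add: a_minus_def X.a_assoc X.r_neg)
    finally show ?thesis by simp
  qed
qed

text \<open>The commutator is \<open>\<delta>\<^bsub>j,k\<^esub> e\<^bsub>i,l\<^esub> - \<delta>\<^bsub>l,i\<^esub> e\<^bsub>k,j\<^esub>\<close>; each of the four combinations of the two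
  Kronecker symbols is covered by one of the relations above.\<close>

lemma b_eq_factor_units:
  assumes ij: "1 \<le> i" "i \<le> p" "q \<le> j" "j \<le> n" and kl: "1 \<le> k" "k \<le> p" "q \<le> l" "l \<le> n"
  shows "b (E i j) (E k l) = factor (E i j * E k l - E k l * E i j)"
proof -
  have in_A: "E i j \<in> carrier A" "E k l \<in> carrier A" using ij kl by (auto intro: unit_in_A)
  have le: "1 \<le> j" "1 \<le> l" using bounds ij kl by auto
  have bA: "b (E r q) (E q s) \<in> carrier X" if "1 \<le> r" "r \<le> p" "q \<le> s" "s \<le> n" for r s
    using factor_term_closed[of "(r, s)"] that by simp
  have "factor (E i j * E k l - E k l * E i j) =
      factor (E i j * E k l) \<ominus>\<^bsub>X\<^esub> factor (E k l * E i j)"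
    using in_A by (intro factor_minus mult_closed)
  also have "factor (E i j * E k l) = (if j = k then b (E i q) (E q l) else \<zero>\<^bsub>X\<^esub>)"
    using ij kl le by (simp add: mat_unit_mult factor_unit factor_zero)
  also have "factor (E k l * E i j) = (if l = i then b (E k q) (E q j) else \<zero>\<^bsub>X\<^esub>)"
    using ij kl le by (simp add: mat_unit_mult factor_unit factor_zero)
  finally have fac: "factor (E i j * E k l - E k l * E i j) =
      (if j = k then b (E i q) (E q l) else \<zero>\<^bsub>X\<^esub>) \<ominus>\<^bsub>X\<^esub> (if l = i then b (E k q) (E q j) else \<zero>\<^bsub>X\<^esub>)" .
  consider "j \<noteq> k" "l \<noteq> i" | "j = k" "l \<noteq> i" | "j \<noteq> k" "l = i" | "j = k" "l = i" by blast
  then show ?thesis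
  proof cases
    case 1
    then show ?thesis using b_units_unlinked[OF ij kl] fac X.r_neg[OF X.zero_closed]
      by (simp add: a_minus_def)
  next
    case 2
    then have "b (E i j) (E k l) = b (E i q) (E q l)"
      using b_units_middle[of i l j q] ij kl qp by simp
    then show ?thesis using 2 fac bA[of i l] ij kl by (simp add: a_minus_def)
  next
    case 3
    then have "b (E k l) (E i j) = b (E k q) (E q j)"
      using b_units_middle[of k j l q] ij kl qp by simp
    then show ?thesis using 3 fac b_skew[OF in_A] bA[of k j] ij kl by (simp add: a_minus_def)
  next
    case 4
    then show ?thesis using b_units_diagonal[of i j] fac ij kl by simp
  qed
qed

end

lemma factor_exists_on_units:
  "\<exists>f \<in> LinearCombinations.module_hom class_ring A X.
     \<forall>x\<in>units. \<forall>y\<in>units. b x y = f (x * y - y * x)"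
proof (cases "q \<le> p")
  case True
  then show ?thesis
    using b_eq_factor_units by (intro bexI[OF _ factor_hom[OF True]]) blast
next
  \<comment> \<open>No column index is a row index, so all products vanish and the zero map works.\<close>
  case False
  have "(\<lambda>_. \<zero>\<^bsub>X\<^esub>) \<in> LinearCombinations.module_hom class_ring A X"
    by (rule module_homI) (auto simp: X.smult_r_null)
  moreover have "b x y = \<zero>\<^bsub>X\<^esub>" if "x \<in> units" "y \<in> units" for x y
  proof -
    from that(1) obtain i j where ij: "1 \<le> i" "i \<le> p" "q \<le> j" "j \<le> n" and x: "x = E i j"
      by blast
    from that(2) obtain k l where kl: "1 \<le> k" "k \<le> p" "q \<le> l" "l \<le> n" and y: "y = E k l"
      by blast
    have "j \<noteq> k" "i \<noteq> l" using False ij kl by auto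
    then show ?thesis unfolding x y by (rule b_units_unlinked[OF ij kl])
  qed
  ultimately show ?thesis by (intro bexI[of _ "\<lambda>_. \<zero>\<^bsub>X\<^esub>"] ballI)
qed

end

theorem proposition14:
  fixes n i\<^sub>1 j\<^sub>1 :: nat
  assumes "n \<ge> 1"
    and "is_ladder 1 n {(i\<^sub>1, j\<^sub>1)}"
  shows "zero_product_determined TYPE('x) class_ring
    (ladder_matrices TYPE('f :: field) n {(i\<^sub>1, j\<^sub>1)})
    (ladder_bracket TYPE('f) n {(i\<^sub>1, j\<^sub>1)})"
proof -
  interpret one_step_ladder "TYPE('f)" n i\<^sub>1 j\<^sub>1
    by unfold_locales (rule assms(2))
  note bracket = ladder_bracket_linear[of n "{(i\<^sub>1, j\<^sub>1)}", OF commutator_closed]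
  let ?K = "class_ring :: 'f ring" and ?\<mu> = "ladder_bracket TYPE('f) n {(i\<^sub>1, j\<^sub>1)}"
  show ?thesis
  proof (rule zero_product_determinedI)
    show K: "field ?K" by (rule class_field)
    have A: "vectorspace ?K A" by (intro vectorspace.intro A_module K)
    then show "nonassoc_algebra ?K A ?\<mu>"
      unfolding nonassoc_algebra_def using bracket(1) by blast
    fix X :: "('f, 'x) module" and b
    assume X: "module ?K X" and b: "bilinear_map ?K A A X b"
      and zero: "\<And>x y. x \<in> carrier A \<Longrightarrow> y \<in> carrier A \<Longrightarrow>
        ?\<mu> (pure_tensor ?K A A x y) = \<zero>\<^bsub>A\<^esub> \<Longrightarrow> b x y = \<zero>\<^bsub>X\<^esub>"
    interpret commutator_factor "TYPE('f)" n i\<^sub>1 j\<^sub>1 X b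
    proof (intro commutator_factor.intro commutator_factor_axioms.intro one_step_ladder_axioms X b zero)
      fix x y assume xy: "x \<in> carrier A" "y \<in> carrier A" "x * y = y * x"
      then show "?\<mu> (pure_tensor ?K A A x y) = \<zero>\<^bsub>A\<^esub>"
        using A_mat[OF mult_closed[OF xy(2,1)]] by (simp add: bracket(2) A_simps)
    qed
    obtain f where f: "f \<in> LinearCombinations.module_hom ?K A X"
      and eq: "\<And>x y. x \<in> units \<Longrightarrow> y \<in> units \<Longrightarrow> b x y = f (x * y - y * x)"
      using factor_exists_on_units by blast
    have \<mu>: "?\<mu> \<in> LinearCombinations.module_hom ?K (tensor ?K A A) A"
      using bracket(1) by (simp add: linear_map_def mod_hom_def mod_hom_axioms_def)
    have "b x y = f (?\<mu> (pure_tensor ?K A A x y))" if "x \<in> carrier A" "y \<in> carrier A" for x y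
    proof (rule bilinear_map_eq_on_span[OF A_module A_module X b _ units_subset A_subset_span
          units_subset A_subset_span _ that])
      show "bilinear_map ?K A A X (\<lambda>x y. f (?\<mu> (pure_tensor ?K A A x y)))"
        by (rule bilinear_map_pure_tensor[OF K A_module A_module module_hom_comp[OF \<mu> f]])
      show "b x y = f (?\<mu> (pure_tensor ?K A A x y))" if "x \<in> units" "y \<in> units" for x y
        using eq[OF that] bracket(2) that units_subset by (simp add: subset_iff)
    qed
    with f show "\<exists>f \<in> LinearCombinations.module_hom ?K A X. \<forall>x\<in>carrier A. \<forall>y\<in>carrier A.
        b x y = f (?\<mu> (pure_tensor ?K A A x y))" by blast
  qed
qed

end
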